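(* Let $\lambda\in\mathbb{R}$, $\delta>0$, $\alpha>|\beta|\geq 0$, and set $\nu=\lambda-1/2$. Suppose that $h:\mathbb{R}\rightarrow\mathbb{R}$ is measurable and bounded, let $\tilde{h}(x)=h(x)-\mathrm{GH}_{\delta,0}^{\lambda,\alpha,\beta}h$, and let $f:\mathbb{R}\to\mathbb{R}$ denote the function \begin{align*}f(x)&=-\frac{\mathrm{e}^{-\beta x}K_{\nu}(\alpha\sqrt{\delta^2+x^2})}{(\delta^2+x^2)^{\nu/2}}\int_0^x \mathrm{e}^{\beta t}(\delta^2+t^2)^{\nu/2}I_{\nu}(\alpha\sqrt{t^2+\delta^2})\tilde{h}(t)\,\mathrm{d}t \\ &\quad-\frac{\mathrm{e}^{-\beta x}I_{\nu}(\alpha\sqrt{\delta^2+x^2})}{(\delta^2+x^2)^{\nu/2}}\int_x^{\infty} \mathrm{e}^{\beta t}(\delta^2+t^2)^{\nu/2}K_{\nu}(\alpha\sqrt{t^2+\delta^2})\tilde{h}(t)\,\mathrm{d}t . \end{align*} Then there exist non-negative constants $C_0$ and $C_1$ such that $\|f\|\leq C_0\|\tilde{h}\|$ and $\|f'\|\leq C_1\|\tilde{h}\|$, where $\|\tilde{h}\|=\|\tilde{h}\|_\infty=\sup_{x\in\mathbb{R}}|\tilde{h}(x)|$ (and likewise for $f$ and $f'$).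
   Context: Modified Bessel functions: for $\nu\in\mathbb{R}$, $I_{\nu}(x)=\sum_{k=0}^{\infty}\frac{1}{\Gamma(\nu+k+1)k!}\left(\frac{x}{2}\right)^{\nu+2k}$ (first kind), and $K_\nu(x)=\int_0^\infty \mathrm{e}^{-x\cosh(t)}\cosh(\nu t)\,\mathrm{d}t$ for $x>0$ (second kind). For $\lambda\in\mathbb{R}$, $\delta>0$, $\alpha>|\beta|\geq0$, the generalized hyperbolic distribution $GH(\lambda,\alpha,\beta,\delta,0)$ is the probability distribution on $\mathbb{R}$ with density $$p(x)=\frac{(\alpha^2 - \beta^2)^{\lambda/2}}{\sqrt{2\pi}\, \alpha^{\lambda -\frac{1}{2}}\delta^{\lambda}K_{\lambda}(\delta\sqrt{\alpha^2-\beta^2})}\,\mathrm{e}^{\beta x}(\delta^2+x^2)^{(\lambda-\frac{1}{2})/2}K_{\lambda-\frac{1}{2}}(\alpha\sqrt{\delta^2+x^2}),\quad x\in\mathbb{R}.$$ $\mathrm{GH}_{\delta,0}^{\lambda,\alpha,\beta}h$ denotes $\mathbb{E}h(X)$ for $X\sim GH(\lambda,\alpha,\beta,\delta,0)$. *)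

theory Defs
  imports "HOL-Analysis.Analysis"
begin

text \<open>
  Both Bessel functions are only meant for \<open>x > 0\<close>. The library's \<open>rGamma\<close> is the entire function
  \<open>1 / \<Gamma>\<close>, so the terms with \<open>\<nu> + k + 1\<close> a nonpositive integer vanish, as is the convention
  for \<open>\<nu>\<close> a negative integer.
\<close>

definition bessel_I :: "real \<Rightarrow> real \<Rightarrow> real" where
  "bessel_I \<nu> x = (\<Sum>k. rGamma (\<nu> + real k + 1) / fact k * (x / 2) powr (\<nu> + 2 * real k))"

definition bessel_K :: "real \<Rightarrow> real \<Rightarrow> real" where
  "bessel_K \<nu> x = (LBINT t=0..\<infinity>. exp (- x * cosh t) * cosh (\<nu> * t))"

definition gh_density :: "real \<Rightarrow> real \<Rightarrow> real \<Rightarrow> real \<Rightarrow> real \<Rightarrow> real" where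
  "gh_density lam \<alpha> \<beta> \<delta> x =
     (\<alpha>\<^sup>2 - \<beta>\<^sup>2) powr (lam / 2) /
       (sqrt (2 * pi) * \<alpha> powr (lam - 1 / 2) * \<delta> powr lam * bessel_K lam (\<delta> * sqrt (\<alpha>\<^sup>2 - \<beta>\<^sup>2)))
     * exp (\<beta> * x) * (\<delta>\<^sup>2 + x\<^sup>2) powr ((lam - 1 / 2) / 2)
     * bessel_K (lam - 1 / 2) (\<alpha> * sqrt (\<delta>\<^sup>2 + x\<^sup>2))"

definition gh_distribution :: "real \<Rightarrow> real \<Rightarrow> real \<Rightarrow> real \<Rightarrow> real measure" where
  "gh_distribution lam \<alpha> \<beta> \<delta> = density lborel (\<lambda>x. ennreal (gh_density lam \<alpha> \<beta> \<delta> x))"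

definition gh_expectation :: "real \<Rightarrow> real \<Rightarrow> real \<Rightarrow> real \<Rightarrow> (real \<Rightarrow> real) \<Rightarrow> real" where
  "gh_expectation lam \<alpha> \<beta> \<delta> h = integral\<^sup>L (gh_distribution lam \<alpha> \<beta> \<delta>) h"

definition gh_centred :: "real \<Rightarrow> real \<Rightarrow> real \<Rightarrow> real \<Rightarrow> (real \<Rightarrow> real) \<Rightarrow> real \<Rightarrow> real" where
  "gh_centred lam \<alpha> \<beta> \<delta> h x = h x - gh_expectation lam \<alpha> \<beta> \<delta> h"

text \<open>
  The first integral is oriented: for \<open>x < 0\<close> it is minus the integral over \<open>(x, 0)\<close>.
\<close>

definition gh_stein_solution ::
    "real \<Rightarrow> real \<Rightarrow> real \<Rightarrow> real \<Rightarrow> (real \<Rightarrow> real) \<Rightarrow> real \<Rightarrow> real" where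
  "gh_stein_solution lam \<alpha> \<beta> \<delta> h x =
     (let \<nu> = lam - 1 / 2; ht = gh_centred lam \<alpha> \<beta> \<delta> h in
      - (exp (- \<beta> * x) * bessel_K \<nu> (\<alpha> * sqrt (\<delta>\<^sup>2 + x\<^sup>2)) / (\<delta>\<^sup>2 + x\<^sup>2) powr (\<nu> / 2))
        * (LBINT t=0..ereal x. exp (\<beta> * t) * (\<delta>\<^sup>2 + t\<^sup>2) powr (\<nu> / 2)
             * bessel_I \<nu> (\<alpha> * sqrt (t\<^sup>2 + \<delta>\<^sup>2)) * ht t)
      - (exp (- \<beta> * x) * bessel_I \<nu> (\<alpha> * sqrt (\<delta>\<^sup>2 + x\<^sup>2)) / (\<delta>\<^sup>2 + x\<^sup>2) powr (\<nu> / 2))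
        * (LBINT t=ereal x..\<infinity>. exp (\<beta> * t) * (\<delta>\<^sup>2 + t\<^sup>2) powr (\<nu> / 2)
             * bessel_K \<nu> (\<alpha> * sqrt (t\<^sup>2 + \<delta>\<^sup>2)) * ht t))"

text \<open>
  Taken in \<open>ennreal\<close>, so that an unbounded function has norm \<open>\<infinity>\<close> and a finite bound on the norm
  includes boundedness.
\<close>

definition sup_norm :: "(real \<Rightarrow> real) \<Rightarrow> ennreal" where
  "sup_norm g = (SUP x. ennreal \<bar>g x\<bar>)"

end

theory Submission
  imports Defs "HOL-Probability.Distributions"
begin

text \<open>
  Let \<open>\<nu> = \<lambda> - 1 / 2\<close> and \<open>r(x) = sqrt (\<delta>\<^sup>2 + x\<^sup>2)\<close>, and let \<open>g\<close> be the centred test function. The solution has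
  the variation of parameters form \<open>f(x) = - u(x) P(x) - v(x) Q(x)\<close>, with \<open>P(x)\<close> the oriented integral of
  \<open>p g\<close> from \<open>0\<close> to \<open>x\<close> and \<open>Q(x)\<close> the integral of \<open>q g\<close> over \<open>(x, \<infinity>)\<close>,
  where \<open>u = W K(\<alpha> r)\<close>, \<open>v = W I(\<alpha> r)\<close>, \<open>p = I(\<alpha> r) / W\<close>, \<open>q = K(\<alpha> r) / W\<close> for the gauge
  \<open>W(x) = exp (- \<beta> x) r(x) powr (- \<nu>)\<close>. On \<open>[\<alpha> \<delta>, \<infinity>)\<close> the functions \<open>I\<close> and \<open>I'\<close> are \<open>O(exp x)\<close>, by an
  energy estimate for the modified Bessel equation (\<open>bessel_I_ode\<close>, \<open>modified_bessel_ode_growth\<close>), and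
  \<open>K\<close> and \<open>K'\<close> are \<open>O(exp (- x))\<close>, directly from the integral (\<open>bessel_K_decay\<close>). The gauge varies
  essentially at the rate \<open>\<bar>\<beta>\<bar> < \<alpha>\<close> (\<open>gh_gauge_ratio\<close>). Hence \<open>u(x) p(t)\<close> and \<open>v(x) q(t)\<close>, and likewise
  \<open>u'(x) p(t)\<close> and \<open>v'(x) q(t)\<close>, are bounded by a multiple of \<open>exp (- c \<bar>x - t\<bar>)\<close> whenever \<open>t\<close> lies between
  \<open>0\<close> and \<open>x\<close>, respectively \<open>x\<close> between \<open>0\<close> and \<open>t\<close>. Integrating this kernel bounds \<open>f\<close> by a constant times
  the norm of \<open>g\<close> if \<open>x \<ge> 0\<close>.

  For \<open>x < 0\<close> the second integral covers the origin, and \<open>v\<close> grows exponentially. Here it matters that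
  \<open>g\<close> is centred: \<open>q\<close> is a multiple of the density, so the integral over \<open>(x, \<infinity>)\<close> is minus the one over
  \<open>(-\<infinity>, x)\<close>, and the same kernel bound applies. The proof that the density has mass one
  (\<open>nn_integral_gh_weight\<close>) is the representation of the law as a normal mean-variance mixture.

  Finally \<open>u p = v q\<close>, so the terms with \<open>g(x)\<close> cancel in the derivative and \<open>f'\<close> has the same form
  as \<open>f\<close>, with \<open>u'\<close>, \<open>v'\<close> in place of \<open>u\<close>, \<open>v\<close>; this is why \<open>f\<close> is differentiable even where \<open>g\<close> is not
  continuous (\<open>variation_of_parameters_bound\<close>).
\<close>


section \<open>The modified Bessel function of the first kind\<close>

text \<open>
  Comparing neighbouring coefficients is all that the power series argument needs: the identity
  gives the ratio test, and it is the modified Bessel equation read coefficientwise. It comes from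
  \<open>1 / \<Gamma>(z) = z / \<Gamma>(z + 1)\<close>, which holds at the poles of \<open>\<Gamma>\<close> as well, so negative integer orders
  are included.
\<close>

lemma bessel_I_coeff_rec:
  fixes \<nu> :: real
  shows "rGamma (\<nu> + real k + 1) / fact k =
    (real k + 1) * (\<nu> + real k + 1) * (rGamma (\<nu> + real (Suc k) + 1) / fact (Suc k))"
proof -
  have "rGamma (\<nu> + real k + 1) = (\<nu> + real k + 1) * rGamma (\<nu> + real (Suc k) + 1)"
    using rGamma_plus1[of "\<nu> + real k + 1"] by (simp add: add_ac)
  moreover have "(fact (Suc k) :: real) = (real k + 1) * fact k" by simp
  moreover have "real k + 1 \<noteq> 0" by linarith
  ultimately show ?thesis by (simp del: fact_Suc of_nat_Suc)
qed

lemma summable_bessel_I_coeff: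
  fixes \<nu> z :: real
  shows "summable (\<lambda>k. rGamma (\<nu> + real k + 1) / fact k * z ^ k)"
proof -
  define c where "c = (\<lambda>k. rGamma (\<nu> + real k + 1) / fact k)"
  have rec: "c k = (real k + 1) * (\<nu> + real k + 1) * c (Suc k)" for k
    unfolding c_def by (rule bessel_I_coeff_rec)
  obtain N :: nat where N: "real N \<ge> \<bar>\<nu>\<bar> + 2 * \<bar>z\<bar>"
    using real_arch_simple by blast
  have "norm (c (Suc n) * z ^ Suc n) \<le> 1 / 2 * norm (c n * z ^ n)" if "n \<ge> N" for n
  proof -
    have a: "\<nu> + real n + 1 \<ge> 1 + 2 * \<bar>z\<bar>" using that N by linarith
    have "2 * \<bar>z\<bar> \<le> (real n + 1) * (\<nu> + real n + 1)"
      using mult_mono[of 1 "real n + 1" "2 * \<bar>z\<bar>" "\<nu> + real n + 1"] a by simp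
    then have "2 * \<bar>z\<bar> * \<bar>c (Suc n)\<bar> \<le> \<bar>c n\<bar>"
      using a by (simp add: rec[of n] abs_mult mult_right_mono)
    then have "2 * \<bar>z\<bar> * \<bar>c (Suc n)\<bar> * \<bar>z\<bar> ^ n \<le> \<bar>c n\<bar> * \<bar>z\<bar> ^ n"
      by (intro mult_right_mono) auto
    then show ?thesis by (simp add: abs_mult power_abs ac_simps)
  qed
  then have "summable (\<lambda>n. c n * z ^ n)" by (intro summable_ratio_test[of "1/2" N]) auto
  then show ?thesis by (simp add: c_def)
qed

text \<open>
  With \<open>a\<^sub>k = 1 / (\<Gamma>(\<nu> + k + 1) k!)\<close> and the entire function \<open>S(z) = \<Sum>a\<^sub>k z\<^sup>k\<close> one has
  \<open>I(x) = (x / 2)\<^sup>\<nu> S(x\<^sup>2 / 4)\<close>. The coefficient recurrence says \<open>z S'' + (\<nu> + 1) S' = S\<close>, and the change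
  of variables turns this into \<open>y'' + y' / x = (1 + \<nu>\<^sup>2 / x\<^sup>2) y\<close>.
\<close>

lemma bessel_I_ode:
  fixes \<nu> :: real
  obtains I' where
    "\<And>x. x > 0 \<Longrightarrow> (bessel_I \<nu> has_real_derivative I' x) (at x)"
    "\<And>x. x > 0 \<Longrightarrow> (I' has_real_derivative (1 + \<nu>\<^sup>2 / x\<^sup>2) * bessel_I \<nu> x - I' x / x) (at x)"
proof -
  define c where "c = (\<lambda>k. rGamma (\<nu> + real k + 1) / fact k)"
  define S where "S = (\<lambda>z::real. \<Sum>k. c k * z ^ k)"
  define S1 where "S1 = (\<lambda>z::real. \<Sum>k. diffs c k * z ^ k)"
  define S2 where "S2 = (\<lambda>z::real. \<Sum>k. diffs (diffs c) k * z ^ k)"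
  have rec: "c k = (real k + 1) * (\<nu> + real k + 1) * c (Suc k)" for k
    unfolding c_def by (rule bessel_I_coeff_rec)
  have s0: "summable (\<lambda>k. c k * z ^ k)" for z
    using summable_bessel_I_coeff by (simp add: c_def)
  have s1: "summable (\<lambda>k. diffs c k * z ^ k)" for z by (rule termdiff_converges_all[OF s0])
  have s2: "summable (\<lambda>k. diffs (diffs c) k * z ^ k)" for z by (rule termdiff_converges_all[OF s1])
  have dS: "(S has_real_derivative S1 z) (at z)" for z
    unfolding S_def S1_def by (rule termdiffs_strong_converges_everywhere[OF s0])
  have dS1: "(S1 has_real_derivative S2 z) (at z)" for z
    unfolding S1_def S2_def by (rule termdiffs_strong_converges_everywhere[OF s1])
  have ode: "z * S2 z + (\<nu> + 1) * S1 z = S z" for z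
  proof -
    have "(\<lambda>k. diffs (diffs c) k * z ^ k) sums S2 z" unfolding S2_def by (rule summable_sums[OF s2])
    then have "(\<lambda>k. z * (diffs (diffs c) k * z ^ k)) sums (z * S2 z)" by (rule sums_mult)
    also have "(\<lambda>k. z * (diffs (diffs c) k * z ^ k)) = (\<lambda>k. real (Suc k) * diffs c (Suc k) * z ^ Suc k)"
      by (simp add: diffs_def fun_eq_iff algebra_simps)
    finally have "(\<lambda>k. real k * diffs c k * z ^ k) sums (z * S2 z + real 0 * diffs c 0 * z ^ 0)"
      by (subst (asm) sums_Suc_iff) simp
    moreover have "(\<lambda>k. (\<nu> + 1) * (diffs c k * z ^ k)) sums ((\<nu> + 1) * S1 z)"
      unfolding S1_def by (intro sums_mult summable_sums s1)
    ultimately have "(\<lambda>k. real k * diffs c k * z ^ k + (\<nu> + 1) * (diffs c k * z ^ k))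
        sums (z * S2 z + (\<nu> + 1) * S1 z)" using sums_add by fastforce
    also have "(\<lambda>k. real k * diffs c k * z ^ k + (\<nu> + 1) * (diffs c k * z ^ k)) = (\<lambda>k. c k * z ^ k)"
    proof
      fix k
      show "real k * diffs c k * z ^ k + (\<nu> + 1) * (diffs c k * z ^ k) = c k * z ^ k"
        unfolding rec[of k] by (simp add: diffs_def algebra_simps)
    qed
    finally show ?thesis unfolding S_def by (simp add: sums_iff)
  qed
  define E where "E = (\<lambda>x::real. (x / 2) powr \<nu>)"
  have dE: "(E has_real_derivative (\<nu> * E x / x)) (at x)" if "x > 0" for x
  proof -
    have "((\<lambda>x. (x / 2) powr \<nu>) has_real_derivative \<nu> * (x / 2) powr (\<nu> - 1) * (1 / 2)) (at x)"
      using that by (intro DERIV_chain2[OF has_real_derivative_powr]) (auto intro!: derivative_eq_intros)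
    moreover have "\<nu> * (x / 2) powr (\<nu> - 1) * (1 / 2) = \<nu> * E x / x"
      using that by (simp add: powr_diff E_def)
    ultimately show ?thesis by (simp add: E_def)
  qed
  define J where "J = (\<lambda>x. E x * S (x\<^sup>2 / 4))"
  define J' where "J' = (\<lambda>x. \<nu> / x * (E x * S (x\<^sup>2 / 4)) + E x * (x / 2) * S1 (x\<^sup>2 / 4))"
  have J: "bessel_I \<nu> x = J x" if "x > 0" for x
  proof -
    have "rGamma (\<nu> + real k + 1) / fact k * (x / 2) powr (\<nu> + 2 * real k) = E x * (c k * (x\<^sup>2 / 4) ^ k)" for k
    proof -
      have "(x / 2) powr (2 * real k) = (x / 2) ^ (2 * k)"
        using that by (subst powr_realpow[symmetric]) auto
      also have "\<dots> = (x\<^sup>2 / 4) ^ k" by (simp add: power_mult power_divide)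
      finally show ?thesis by (simp add: powr_add E_def c_def)
    qed
    then show ?thesis unfolding bessel_I_def J_def S_def
      by (simp add: suminf_mult[OF s0])
  qed
  have dSc: "((\<lambda>x. S (x\<^sup>2 / 4)) has_real_derivative S1 (x\<^sup>2 / 4) * (x / 2)) (at x)" for x
    by (rule DERIV_chain2[OF dS]) (auto intro!: derivative_eq_intros)
  have dS1c: "((\<lambda>x. S1 (x\<^sup>2 / 4)) has_real_derivative S2 (x\<^sup>2 / 4) * (x / 2)) (at x)" for x
    by (rule DERIV_chain2[OF dS1]) (auto intro!: derivative_eq_intros)
  have dJ: "(J has_real_derivative J' x) (at x)" if "x > 0" for x
    unfolding J_def J'_def using that
    by (auto intro!: derivative_eq_intros dE dSc simp: field_simps)
  have dJ': "(J' has_real_derivative (1 + \<nu>\<^sup>2 / x\<^sup>2) * J x - J' x / x) (at x)" if "x > 0" for x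
  proof -
    have dq: "((\<lambda>x. \<nu> / x) has_real_derivative - \<nu> / x\<^sup>2) (at x)"
      using that by (auto intro!: derivative_eq_intros simp: power2_eq_square)
    have dh: "((\<lambda>x. x / 2) has_real_derivative 1 / 2) (at x)"
      by (auto intro!: derivative_eq_intros)
    have "(J' has_real_derivative
       (- \<nu> / x\<^sup>2 * (E x * S (x\<^sup>2 / 4)) + \<nu> / x * (\<nu> * E x / x * S (x\<^sup>2 / 4) + E x * (S1 (x\<^sup>2 / 4) * (x / 2)))
        + ((\<nu> * E x / x * (x / 2) + E x * (1/2)) * S1 (x\<^sup>2 / 4) + E x * (x / 2) * (S2 (x\<^sup>2 / 4) * (x / 2))))) (at x)"
      unfolding J'_def
      by (rule DERIV_cong[OF DERIV_add[OF DERIV_mult[OF dq DERIV_mult[OF dE[OF that] dSc]]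
            DERIV_mult[OF DERIV_mult[OF dE[OF that] dh] dS1c]]]) (simp add: algebra_simps)
    also have "(- \<nu> / x\<^sup>2 * (E x * S (x\<^sup>2 / 4)) + \<nu> / x * (\<nu> * E x / x * S (x\<^sup>2 / 4) + E x * (S1 (x\<^sup>2 / 4) * (x / 2)))
        + ((\<nu> * E x / x * (x / 2) + E x * (1/2)) * S1 (x\<^sup>2 / 4) + E x * (x / 2) * (S2 (x\<^sup>2 / 4) * (x / 2))))
       = E x * (x\<^sup>2 / 4 * S2 (x\<^sup>2 / 4) + (\<nu> + 1) * S1 (x\<^sup>2 / 4)) + \<nu>\<^sup>2 / x\<^sup>2 * J x - J' x / x"
      using that by (simp add: J_def J'_def field_simps power2_eq_square)
    also have "\<dots> = (1 + \<nu>\<^sup>2 / x\<^sup>2) * J x - J' x / x"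
      unfolding ode by (simp add: J_def algebra_simps)
    finally show ?thesis .
  qed
  show ?thesis
  proof (rule that)
    show "(bessel_I \<nu> has_real_derivative J' x) (at x)" if "x > 0" for x
      by (rule has_field_derivative_transform_within_open[OF dJ[OF that], of "{0<..}"]) (use that J in auto)
    show "(J' has_real_derivative (1 + \<nu>\<^sup>2 / x\<^sup>2) * bessel_I \<nu> x - J' x / x) (at x)" if "x > 0" for x
      using dJ'[OF that] J[OF that] by simp
  qed
qed

text \<open>
  An energy estimate, which bounds \<open>I\<close> and its derivative for every real order at once; it asks
  neither for an integral representation nor for the asymptotic expansion. For \<open>N = y\<^sup>2 + y'\<^sup>2\<close> the
  equation gives \<open>N' = 2 y y' (2 + \<nu>\<^sup>2 / x\<^sup>2) - 2 y'\<^sup>2 / x \<le> (2 + \<nu>\<^sup>2 / x\<^sup>2) N\<close>, so \<open>N\<close> grows at most like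
  \<open>exp (2 x - \<nu>\<^sup>2 / x)\<close>.
\<close>

lemma modified_bessel_ode_growth:
  fixes y y' :: "real \<Rightarrow> real" and \<nu> x0 :: real
  assumes x0: "x0 > 0"
    and dy: "\<And>x. x \<ge> x0 \<Longrightarrow> (y has_real_derivative y' x) (at x)"
    and dy': "\<And>x. x \<ge> x0 \<Longrightarrow> (y' has_real_derivative (1 + \<nu>\<^sup>2 / x\<^sup>2) * y x - y' x / x) (at x)"
  obtains C where "C \<ge> 0" "\<And>x. x \<ge> x0 \<Longrightarrow> \<bar>y x\<bar> \<le> C * exp x" "\<And>x. x \<ge> x0 \<Longrightarrow> \<bar>y' x\<bar> \<le> C * exp x"
proof -
  define N where "N = (\<lambda>x. (y x)\<^sup>2 + (y' x)\<^sup>2)"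
  \<comment> \<open>The reciprocal of the growth factor: \<open>W' = - (2 + \<nu>\<^sup>2 / x\<^sup>2) W\<close>, so \<open>N W\<close> is nonincreasing.\<close>
  define W where "W = (\<lambda>x. exp (\<nu>\<^sup>2 / x - 2 * x))"
  have Npos: "N x \<ge> 0" and Wpos: "W x > 0" for x by (auto simp: N_def W_def)
  have mono: "N x * W x \<le> N x0 * W x0" if "x \<ge> x0" for x
  proof (rule DERIV_nonpos_imp_nonincreasing[OF that])
    fix t assume t: "x0 \<le> t" "t \<le> x"
    then have t0: "t > 0" using x0 by simp
    define a where "a = 2 + \<nu>\<^sup>2 / t\<^sup>2"
    have a: "a \<ge> 0" by (simp add: a_def)
    define N' where "N' = 2 * y t * y' t * a - 2 * (y' t)\<^sup>2 / t"
    have dN: "(N has_real_derivative N') (at t)"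
      unfolding N_def using t t0
      by (auto intro!: derivative_eq_intros dy dy' simp: N'_def a_def field_simps power2_eq_square)
    have dW: "(W has_real_derivative - W t * a) (at t)"
      unfolding W_def using t0
      by (auto intro!: derivative_eq_intros simp: a_def field_simps power2_eq_square)
    have "2 * y t * y' t \<le> N t"
      using sum_squares_bound[of "y t" "y' t"] by (simp add: N_def)
    then have "N' \<le> N t * a"
      unfolding N'_def using a t0 mult_right_mono[of "2 * y t * y' t" "N t" a]
      by (smt (verit) divide_nonneg_pos zero_le_power2)
    then have "N' * W t \<le> N t * a * W t" using Wpos[of t] by (simp add: mult_right_mono)
    then have "N' * W t + - W t * a * N t \<le> 0" by (simp add: algebra_simps)
    moreover have "((\<lambda>x. N x * W x) has_real_derivative N' * W t + - W t * a * N t) (at t)"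
      by (rule DERIV_mult[OF dN dW])
    ultimately show "\<exists>d. ((\<lambda>x. N x * W x) has_real_derivative d) (at t) \<and> d \<le> 0" by blast
  qed
  define C where "C = sqrt (N x0 * W x0)"
  have bd: "N x \<le> (C * exp x)\<^sup>2" if "x \<ge> x0" for x
  proof -
    have "exp (- 2 * x) \<le> W x" using that x0 by (simp add: W_def)
    then have "N x * exp (- 2 * x) \<le> N x * W x" by (intro mult_left_mono Npos)
    also have "\<dots> \<le> C\<^sup>2" using mono[OF that] Npos[of x0] Wpos[of x0] by (simp add: C_def less_imp_le)
    finally have "N x * exp (- 2 * x) * exp (2 * x) \<le> C\<^sup>2 * exp (2 * x)" by (intro mult_right_mono) auto
    then show ?thesis by (simp add: power_mult_distrib mult.assoc flip: exp_add exp_double)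
  qed
  have C: "C \<ge> 0" using Npos[of x0] Wpos[of x0] by (simp add: C_def less_imp_le)
  show ?thesis
  proof (rule that[of C])
    fix x assume x: "x \<ge> x0"
    have "\<bar>y x\<bar>\<^sup>2 \<le> (C * exp x)\<^sup>2" by (rule order_trans[OF _ bd[OF x]]) (simp add: N_def)
    then show "\<bar>y x\<bar> \<le> C * exp x" by (rule power2_le_imp_le) (use C in auto)
    have "\<bar>y' x\<bar>\<^sup>2 \<le> (C * exp x)\<^sup>2" by (rule order_trans[OF _ bd[OF x]]) (simp add: N_def)
    then show "\<bar>y' x\<bar> \<le> C * exp x" by (rule power2_le_imp_le) (use C in auto)
  qed (use C in auto)
qed

section \<open>The modified Bessel function of the second kind\<close>

lemma has_real_derivativeI_remainder:
  fixes F :: "real \<Rightarrow> real"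
  assumes "\<And>e. e > 0 \<Longrightarrow> \<exists>d>0. \<forall>y. \<bar>y - x\<bar> < d \<longrightarrow> \<bar>F y - F x - D * (y - x)\<bar> \<le> e * \<bar>y - x\<bar>"
  shows "(F has_real_derivative D) (at x)"
  unfolding has_field_derivative_def has_derivative_at_alt
  using assms by (auto intro: bounded_linear_mult_right)

lemma integrable_exp_neg_abs:
  fixes c :: real
  assumes "c > 0"
  shows "integrable lborel (\<lambda>t. exp (- c * \<bar>t\<bar>))"
proof -
  interpret prob_space "density lborel (exponential_density c)"
    by (rule prob_space_exponential_density[OF assms])
  have nn: "exponential_density c t \<ge> 0" for t
    using assms by (simp add: exponential_density_def)
  have "integral\<^sup>N lborel (\<lambda>t. ennreal (exponential_density c t)) = 1"
    using emeasure_space_1 by (simp add: emeasure_density)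
  then have i1: "integrable lborel (exponential_density c)"
    using nn by (intro integrableI_nonneg) auto
  then have i2: "integrable lborel (\<lambda>t. exponential_density c (- t))"
    using lborel_integrable_real_affine[of "exponential_density c" "-1" 0] by simp
  have "integrable lborel (\<lambda>t. (exponential_density c t + exponential_density c (- t)) / c)"
    using i1 i2 by simp
  then show ?thesis
    by (rule Bochner_Integration.integrable_bound)
       (use assms in \<open>auto simp: exponential_density_def abs_if\<close>)
qed

text \<open>
  The double exponential beats every power of \<open>exp \<bar>t\<bar>\<close>: with \<open>Y = x exp \<bar>t\<bar> / 2 \<le> x cosh t\<close> this is
  \<open>exp (- Y) \<le> (n / Y)\<^sup>n\<close>.
\<close>

lemma exp_neg_cosh_le:
  fixes x t :: real
  assumes x: "x > 0" and n: "n > 0"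
  shows "exp (- x * cosh t) \<le> (2 * real n / x) ^ n * exp (- real n * \<bar>t\<bar>)"
proof -
  define Y where "Y = x * exp \<bar>t\<bar> / 2"
  have Y: "Y > 0" using x by (simp add: Y_def)
  have "exp \<bar>t\<bar> / 2 \<le> cosh t"
    by (cases "t \<ge> 0") (auto simp: cosh_def)
  then have "Y \<le> x * cosh t" using x mult_left_mono[of "exp \<bar>t\<bar> / 2" "cosh t" x] by (simp add: Y_def)
  then have le: "exp (- x * cosh t) \<le> exp (- Y)" by simp
  have "(Y / n) ^ n \<le> (1 + Y / n) ^ n" using Y by (intro power_mono) auto
  also have "\<dots> \<le> exp Y"
    using exp_ge_one_plus_x_over_n_power_n[of n Y] Y n by simp
  finally have "(Y / n) ^ n \<le> exp Y" .
  then have "exp (- Y) \<le> inverse ((Y / n) ^ n)"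
    unfolding exp_minus using Y n by (intro le_imp_inverse_le) auto
  also have "\<dots> = (2 * real n / x) ^ n * exp (- real n * \<bar>t\<bar>)"
    using x n unfolding Y_def
    by (simp add: exp_minus power_mult_distrib power_divide field_simps flip: exp_of_nat_mult)
  finally show ?thesis by (rule order_trans[OF le])
qed

lemma integrable_bessel_K_kernel:
  fixes x \<nu> :: real
  assumes x: "x > 0"
  shows "integrable lborel (\<lambda>t. cosh t ^ m * exp (\<nu> * t - x * cosh t))"
proof -
  \<comment> \<open>Large enough to absorb \<open>cosh t ^ m * exp (\<nu> * t)\<close> and leave a factor \<open>exp (- \<bar>t\<bar>)\<close> over.\<close>
  define n where "n = Suc (m + nat \<lceil>\<bar>\<nu>\<bar>\<rceil>)"
  define C where "C = (2 * real n / x) ^ n"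
  have C: "C \<ge> 0" using x by (simp add: C_def)
  have n: "n > 0" "real m + \<bar>\<nu>\<bar> - real n \<le> -1" unfolding n_def by linarith+
  have "integrable lborel (\<lambda>t. C * exp (- 1 * \<bar>t\<bar>))"
    by (intro integrable_mult_right integrable_exp_neg_abs) auto
  then show ?thesis
  proof (rule Bochner_Integration.integrable_bound)
    show "AE t in lborel. norm (cosh t ^ m * exp (\<nu> * t - x * cosh t)) \<le> norm (C * exp (- 1 * \<bar>t\<bar>))"
    proof (rule AE_I2)
      fix t :: real
      have "cosh t \<le> exp \<bar>t\<bar>" by (cases "t \<ge> 0") (auto simp: cosh_def)
      then have "cosh t ^ m \<le> exp (real m * \<bar>t\<bar>)"
        by (simp add: exp_of_nat_mult power_mono)
      moreover have "\<nu> * t \<le> \<bar>\<nu>\<bar> * \<bar>t\<bar>" by (metis abs_ge_self abs_mult)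
      then have "exp (\<nu> * t) \<le> exp (\<bar>\<nu>\<bar> * \<bar>t\<bar>)" by simp
      ultimately have "cosh t ^ m * (exp (\<nu> * t) * exp (- x * cosh t))
          \<le> exp (real m * \<bar>t\<bar>) * (exp (\<bar>\<nu>\<bar> * \<bar>t\<bar>) * (C * exp (- real n * \<bar>t\<bar>)))"
        unfolding C_def using exp_neg_cosh_le[OF x n(1)] by (intro mult_mono) auto
      also have "\<dots> = C * exp ((real m + \<bar>\<nu>\<bar> - real n) * \<bar>t\<bar>)"
        by (simp add: left_diff_distrib distrib_right exp_add exp_diff exp_minus field_simps)
      also have "\<dots> \<le> C * exp (- 1 * \<bar>t\<bar>)"
        using C mult_right_mono[OF n(2), of "\<bar>t\<bar>"] by (intro mult_left_mono) auto
      finally show "norm (cosh t ^ m * exp (\<nu> * t - x * cosh t)) \<le> norm (C * exp (- 1 * \<bar>t\<bar>))"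
        using C by (simp add: exp_diff exp_minus field_simps abs_mult)
    qed
  qed (auto intro!: borel_measurable_continuous_onI continuous_intros)
qed

text \<open>
  Writing \<open>2 cosh (\<nu> t) = exp (\<nu> t) + exp (- \<nu> t)\<close> and reflecting the second half gives an integral
  over the whole line, on which one may translate the variable; all later arguments use this form.
\<close>

lemma bessel_K_eq_integral_line:
  fixes x \<nu> :: real
  assumes x: "x > 0"
  shows "bessel_K \<nu> x = (\<integral>t. exp (\<nu> * t - x * cosh t) \<partial>lborel) / 2"
proof -
  define g where "g = (\<lambda>t. exp (\<nu> * t - x * cosh t))"
  have ig: "integrable lborel g"
    using integrable_bessel_K_kernel[OF x, of 0 \<nu>] by (simp add: g_def)
  have gm: "g \<in> borel_measurable borel" using ig by auto
  have i1: "integrable lborel (\<lambda>t. indicator {0<..} t * g t)"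
    using integrable_mult_indicator[of "{0<..}" lborel g] ig by simp
  have i2: "integrable lborel (\<lambda>t. indicator {..<0} t * g t)"
    using integrable_mult_indicator[of "{..<0}" lborel g] ig by simp
  have i3: "integrable lborel (\<lambda>t. indicator {0<..} t * g (- t))"
    using lborel_integrable_real_affine[OF i2, of "-1" 0]
    by (simp add: indicator_def if_distrib cong: if_cong)
  have "(\<integral>t. g t \<partial>lborel) = (\<integral>t. indicator {0<..} t * g t + indicator {..<0} t * g t \<partial>lborel)"
  proof (rule integral_cong_AE)
    have "AE t in lborel. t \<noteq> (0::real)" by (rule AE_lborel_singleton)
    then show "AE t in lborel. g t = indicator {0<..} t * g t + indicator {..<0} t * g t"
      by eventually_elim (auto simp: indicator_def)
  qed (use ig i1 i2 in auto)
  also have "\<dots> = (\<integral>t. indicator {0<..} t * g t \<partial>lborel) + (\<integral>t. indicator {..<0} t * g t \<partial>lborel)"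
    using i1 i2 by simp
  also have "(\<integral>t. indicator {..<0} t * g t \<partial>lborel) = (\<integral>t. indicator {0<..} t * g (- t) \<partial>lborel)"
    using lborel_integral_real_affine[of "-1" "\<lambda>t. indicator {..<0} t * g t" 0]
    by (simp add: indicator_def if_distrib cong: if_cong)
  also have "(\<integral>t. indicator {0<..} t * g t \<partial>lborel) + (\<integral>t. indicator {0<..} t * g (- t) \<partial>lborel)
      = (\<integral>t. 2 * (indicator {0<..} t * (exp (- x * cosh t) * cosh (\<nu> * t))) \<partial>lborel)"
    by (subst Bochner_Integration.integral_add[OF i1 i3, symmetric])
       (intro Bochner_Integration.integral_cong,
        auto simp: g_def cosh_def indicator_def algebra_simps simp flip: exp_add)
  also have "\<dots> = 2 * bessel_K \<nu> x"
    unfolding bessel_K_def interval_lebesgue_integral_0_infty set_lebesgue_integral_def by simp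
  finally show ?thesis by (simp add: g_def)
qed

text \<open>
  The derivative of \<open>K\<close> up to sign, so that the integrand is positive.
\<close>

definition bessel_K_slope :: "real \<Rightarrow> real \<Rightarrow> real" where
  "bessel_K_slope \<nu> x = (\<integral>t. cosh t * exp (\<nu> * t - x * cosh t) \<partial>lborel) / 2"

text \<open>
  Differentiation under the integral sign. With \<open>z = - (y - x) cosh t\<close> the remainder of the
  integrand is \<open>exp (\<nu> t - x cosh t) (exp z - 1 - z)\<close>. As long as \<open>\<bar>y - x\<bar> < x / 2\<close>, Taylor's bound
  \<open>\<bar>exp z - 1 - z\<bar> \<le> z\<^sup>2 exp \<bar>z\<bar>\<close> costs half of the decay rate \<open>x\<close> and leaves an integrable majorant
  times \<open>(y - x)\<^sup>2\<close>.
\<close>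

lemma bessel_K_has_derivative:
  fixes x \<nu> :: real
  assumes x: "x > 0"
  shows "(bessel_K \<nu> has_real_derivative - bessel_K_slope \<nu> x) (at x)"
proof (rule has_real_derivativeI_remainder)
  fix e :: real assume e: "e > 0"
  define G where "G = (\<lambda>y t. exp (\<nu> * t - y * cosh t))"
  define M where "M = (\<integral>t. cosh t ^ 2 * G (x / 2) t \<partial>lborel)"
  have iM: "integrable lborel (\<lambda>t. cosh t ^ 2 * G (x / 2) t)"
    unfolding G_def by (rule integrable_bessel_K_kernel) (use x in auto)
  have i0: "integrable lborel (G y)" if "y > 0" for y
    using integrable_bessel_K_kernel[OF that, of 0 \<nu>] by (simp add: G_def)
  have i1: "integrable lborel (\<lambda>t. cosh t * G x t)"
    using integrable_bessel_K_kernel[OF x, of 1 \<nu>] by (simp add: G_def)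
  have M0: "M \<ge> 0" unfolding M_def by (rule integral_nonneg_AE) (auto simp: G_def)
  have rem: "\<bar>bessel_K \<nu> y - bessel_K \<nu> x - (- bessel_K_slope \<nu> x) * (y - x)\<bar> \<le> M * (y - x)\<^sup>2"
    if y: "\<bar>y - x\<bar> < x / 2" for y
  proof -
    have y0: "y > 0" using y by linarith
    define R where "R = (\<lambda>t. G y t - G x t + (y - x) * (cosh t * G x t))"
    have iR: "integrable lborel R" unfolding R_def using i0[OF x] i0[OF y0] i1 by auto
    have GI: "(\<integral>t. exp (\<nu> * t - y * cosh t) \<partial>lborel) = integral\<^sup>L lborel (G y)" for y
      by (simp add: G_def)
    have GI1: "(\<integral>t. cosh t * exp (\<nu> * t - x * cosh t) \<partial>lborel) = (\<integral>t. cosh t * G x t \<partial>lborel)"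
      by (simp add: G_def)
    have "bessel_K \<nu> y - bessel_K \<nu> x - (- bessel_K_slope \<nu> x) * (y - x) = (\<integral>t. R t \<partial>lborel) / 2"
      unfolding R_def bessel_K_eq_integral_line[OF x] bessel_K_eq_integral_line[OF y0]
        bessel_K_slope_def GI GI1
      using i0[OF x] i0[OF y0] i1 by (simp add: field_simps)
    moreover have "\<bar>\<integral>t. R t \<partial>lborel\<bar> \<le> (\<integral>t. (y - x)\<^sup>2 * (cosh t ^ 2 * G (x / 2) t) \<partial>lborel)"
    proof (rule integral_abs_bound_integral[OF iR])
      fix t :: real
      define z where "z = - (y - x) * cosh t"
      have "\<bar>exp z - (1 + z)\<bar> \<le> exp \<bar>z\<bar> * z\<^sup>2"
        using Taylor_exp_field[of z 1] by (simp add: power2_eq_square)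
      then have "\<bar>G x t * (exp z - (1 + z))\<bar> \<le> G x t * (exp \<bar>z\<bar> * z\<^sup>2)"
        by (simp add: abs_mult G_def)
      moreover have "G x t * exp z = G y t"
        by (simp add: z_def G_def algebra_simps flip: exp_add)
      then have "G x t * (exp z - (1 + z)) = R t"
        unfolding R_def by (simp add: z_def algebra_simps)
      moreover have "G x t * exp \<bar>z\<bar> \<le> G (x / 2) t"
      proof -
        have "\<bar>z\<bar> \<le> x / 2 * cosh t"
          using y by (simp add: z_def abs_mult mult_right_mono del: minus_diff_eq)
        then show ?thesis by (simp add: G_def flip: exp_add)
      qed
      then have "G x t * exp \<bar>z\<bar> * z\<^sup>2 \<le> G (x / 2) t * z\<^sup>2" by (intro mult_right_mono) auto
      ultimately have "\<bar>R t\<bar> \<le> G (x / 2) t * z\<^sup>2"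
        by (simp only: mult.assoc)
      also have "z\<^sup>2 = (y - x)\<^sup>2 * cosh t ^ 2"
        by (simp only: z_def power_mult_distrib power2_minus)
      finally show "\<bar>R t\<bar> \<le> (y - x)\<^sup>2 * (cosh t ^ 2 * G (x / 2) t)"
        by (simp add: mult_ac)
    qed (use iM in auto)
    then have "\<bar>\<integral>t. R t \<partial>lborel\<bar> \<le> (y - x)\<^sup>2 * M" using iM by (simp add: M_def)
    moreover have "0 \<le> (y - x)\<^sup>2 * M" using M0 by simp
    ultimately show ?thesis by (simp add: mult.commute)
  qed
  show "\<exists>d>0. \<forall>y. \<bar>y - x\<bar> < d \<longrightarrow>
      \<bar>bessel_K \<nu> y - bessel_K \<nu> x - (- bessel_K_slope \<nu> x) * (y - x)\<bar> \<le> e * \<bar>y - x\<bar>"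
  proof (intro exI[of _ "min (x / 2) (e / (M + 1))"] conjI allI impI)
    show "0 < min (x / 2) (e / (M + 1))" using x e M0 by simp
    fix y assume y: "\<bar>y - x\<bar> < min (x / 2) (e / (M + 1))"
    have "M * (y - x)\<^sup>2 = M * \<bar>y - x\<bar> * \<bar>y - x\<bar>" by (simp add: power2_eq_square)
    also have "M * \<bar>y - x\<bar> \<le> (M + 1) * (e / (M + 1))" using y M0 by (intro mult_mono) auto
    also have "\<dots> = e" using M0 by simp
    finally have "M * (y - x)\<^sup>2 \<le> e * \<bar>y - x\<bar>" by (simp add: mult_right_mono)
    then show "\<bar>bessel_K \<nu> y - bessel_K \<nu> x - (- bessel_K_slope \<nu> x) * (y - x)\<bar> \<le> e * \<bar>y - x\<bar>"
      using rem[of y] y by simp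
  qed
qed

text \<open>
  Since \<open>cosh t \<ge> 1\<close>, the factor \<open>exp (- (x - x0) cosh t)\<close> is at most \<open>exp (x0 - x)\<close>.
\<close>

lemma bessel_K_kernel_decay:
  fixes \<nu> x0 x :: real
  assumes x0: "x0 > 0" and x: "x \<ge> x0"
  shows "(\<integral>t. cosh t ^ m * exp (\<nu> * t - x * cosh t) \<partial>lborel)
    \<le> exp (x0 - x) * (\<integral>t. cosh t ^ m * exp (\<nu> * t - x0 * cosh t) \<partial>lborel)"
proof -
  have "(\<integral>t. cosh t ^ m * exp (\<nu> * t - x * cosh t) \<partial>lborel)
    \<le> (\<integral>t. exp (x0 - x) * (cosh t ^ m * exp (\<nu> * t - x0 * cosh t)) \<partial>lborel)"
  proof (rule integral_mono)
    fix t :: real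
    have "(x - x0) * 1 \<le> (x - x0) * cosh t"
      using x by (intro mult_left_mono cosh_real_ge_1) auto
    then have "\<nu> * t - x * cosh t \<le> (x0 - x) + (\<nu> * t - x0 * cosh t)" by (simp add: algebra_simps)
    then have "exp (\<nu> * t - x * cosh t) \<le> exp (x0 - x) * exp (\<nu> * t - x0 * cosh t)"
      by (simp flip: exp_add)
    then have "cosh t ^ m * exp (\<nu> * t - x * cosh t) \<le> cosh t ^ m * (exp (x0 - x) * exp (\<nu> * t - x0 * cosh t))"
      by (intro mult_left_mono) auto
    then show "cosh t ^ m * exp (\<nu> * t - x * cosh t) \<le> exp (x0 - x) * (cosh t ^ m * exp (\<nu> * t - x0 * cosh t))"
      by (simp add: mult_ac)
  qed (use x0 x integrable_bessel_K_kernel in auto)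
  then show ?thesis by simp
qed

lemma bessel_K_pos:
  fixes x \<nu> :: real
  assumes x: "x > 0"
  shows "bessel_K \<nu> x > 0"
proof -
  have i: "integrable lborel (\<lambda>t. exp (\<nu> * t - x * cosh t))"
    using integrable_bessel_K_kernel[OF x, of 0 \<nu>] by simp
  have "(\<integral>t. exp (\<nu> * t - x * cosh t) \<partial>lborel) \<noteq> 0"
    using integral_nonneg_eq_0_iff_AE[OF i] by (simp add: eventually_False ae_filter_eq_bot_iff)
  moreover have "(\<integral>t. exp (\<nu> * t - x * cosh t) \<partial>lborel) \<ge> 0" by simp
  ultimately show ?thesis unfolding bessel_K_eq_integral_line[OF x] by linarith
qed

lemma bessel_K_decay:
  fixes \<nu> x0 :: real
  assumes x0: "x0 > 0"
  obtains C where "C \<ge> 0" "\<And>x. x \<ge> x0 \<Longrightarrow> \<bar>bessel_K \<nu> x\<bar> \<le> C * exp (- x)"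
    "\<And>x. x \<ge> x0 \<Longrightarrow> \<bar>bessel_K_slope \<nu> x\<bar> \<le> C * exp (- x)"
proof
  define C where "C = exp x0 * max (bessel_K \<nu> x0) (bessel_K_slope \<nu> x0)"
  have s0: "bessel_K_slope \<nu> x \<ge> 0" for x
    unfolding bessel_K_slope_def by (auto intro!: integral_nonneg_AE)
  show "C \<ge> 0" using bessel_K_pos[OF x0, of \<nu>] by (auto simp: C_def max_def)
  fix x assume x: "x \<ge> x0"
  have "bessel_K \<nu> x \<le> exp (x0 - x) * bessel_K \<nu> x0"
    using bessel_K_kernel_decay[OF x0 x, of 0 \<nu>] x0 x by (simp add: bessel_K_eq_integral_line)
  also have "\<dots> \<le> exp (x0 - x) * max (bessel_K \<nu> x0) (bessel_K_slope \<nu> x0)"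
    by (intro mult_left_mono) auto
  finally show "\<bar>bessel_K \<nu> x\<bar> \<le> C * exp (- x)"
    using bessel_K_pos[of x \<nu>] x x0 by (simp add: C_def exp_diff exp_minus field_simps)
  have "bessel_K_slope \<nu> x \<le> exp (x0 - x) * bessel_K_slope \<nu> x0"
    using bessel_K_kernel_decay[OF x0 x, of 1 \<nu>] x0 x by (simp add: bessel_K_slope_def)
  also have "\<dots> \<le> exp (x0 - x) * max (bessel_K \<nu> x0) (bessel_K_slope \<nu> x0)"
    by (intro mult_left_mono) auto
  finally show "\<bar>bessel_K_slope \<nu> x\<bar> \<le> C * exp (- x)"
    using s0[of x] by (simp add: C_def exp_diff exp_minus field_simps)
qed

section \<open>The total mass of the generalized hyperbolic density\<close>

text \<open>
  The normalising integral of the generalised inverse Gaussian law, in the logarithmic variable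
  \<open>s\<close>: translating by \<open>ln m\<close> symmetrises \<open>exp s / m + m exp (- s)\<close> to \<open>2 cosh\<close>. It serves twice below,
  to expand the weight as a mixture and to evaluate its total mass.
\<close>

lemma bessel_K_gig:
  fixes lam z m :: real
  assumes z: "z > 0" and m: "m > 0"
  shows "integrable lborel (\<lambda>s. exp (lam * s - z * (exp s / m + m * exp (- s)) / 2))"
    and "(\<integral>s. exp (lam * s - z * (exp s / m + m * exp (- s)) / 2) \<partial>lborel) = 2 * m powr lam * bessel_K lam z"
proof -
  define f where "f = (\<lambda>t. m powr lam * exp (lam * t - z * cosh t))"
  have f: "integrable lborel f"
    unfolding f_def using integrable_bessel_K_kernel[OF z, of 0 lam] by simp
  have shift: "f (- ln m + 1 * s) = exp (lam * s - z * (exp s / m + m * exp (- s)) / 2)" for s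
  proof -
    have "cosh (- ln m + 1 * s) = (exp s / m + m * exp (- s)) / 2"
      using m by (simp add: cosh_def exp_diff exp_minus field_simps)
    moreover have "m powr lam * exp (lam * (- ln m + 1 * s) - w) = exp (lam * s - w)" for w
      using m by (simp add: powr_def algebra_simps flip: exp_add)
    ultimately show ?thesis by (simp add: f_def)
  qed
  show "integrable lborel (\<lambda>s. exp (lam * s - z * (exp s / m + m * exp (- s)) / 2))"
    using lborel_integrable_real_affine[OF f, of 1 "- ln m"] unfolding shift by simp
  have "(\<integral>s. exp (lam * s - z * (exp s / m + m * exp (- s)) / 2) \<partial>lborel) = (\<integral>t. f t \<partial>lborel)"
    using lborel_integral_real_affine[of 1 f "- ln m"] unfolding shift by simp
  also have "\<dots> = 2 * m powr lam * bessel_K lam z"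
    unfolding f_def bessel_K_eq_integral_line[OF z] by simp
  finally show "(\<integral>s. exp (lam * s - z * (exp s / m + m * exp (- s)) / 2) \<partial>lborel) = 2 * m powr lam * bessel_K lam z" .
qed

lemma nn_integral_gaussian_tilted:
  fixes \<beta> v :: real
  assumes v: "v > 0"
  shows "(\<integral>\<^sup>+x. ennreal (exp (\<beta> * x - x\<^sup>2 / (2 * v))) \<partial>lborel) = ennreal (sqrt (2 * pi * v) * exp (\<beta>\<^sup>2 * v / 2))"
proof -
  define c where "c = sqrt (2 * pi * v) * exp (\<beta>\<^sup>2 * v / 2)"
  have c: "c \<ge> 0" using v by (simp add: c_def)
  have sq: "- (x - \<beta> * v)\<^sup>2 / (2 * v) + \<beta>\<^sup>2 * v / 2 = \<beta> * x - x\<^sup>2 / (2 * v)" for x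
    using v by (simp add: field_simps power2_eq_square)
  have "exp (\<beta> * x - x\<^sup>2 / (2 * v)) = c * normal_density (\<beta> * v) (sqrt v) x" for x
    unfolding normal_density_def c_def using v by (simp add: sq[symmetric] flip: exp_add)
  then have "(\<integral>\<^sup>+x. ennreal (exp (\<beta> * x - x\<^sup>2 / (2 * v))) \<partial>lborel)
      = (\<integral>\<^sup>+x. ennreal c * ennreal (normal_density (\<beta> * v) (sqrt v) x) \<partial>lborel)"
    using c by (simp add: ennreal_mult)
  also have "\<dots> = ennreal c * (\<integral>\<^sup>+x. ennreal (normal_density (\<beta> * v) (sqrt v) x) \<partial>lborel)"
    by (rule nn_integral_cmult) simp
  also have "(\<integral>\<^sup>+x. ennreal (normal_density (\<beta> * v) (sqrt v) x) \<partial>lborel) = 1"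
    using v by (subst nn_integral_eq_integral) auto
  finally show ?thesis by (simp add: c_def)
qed

lemma square_less_square_of_abs_less:
  fixes a b :: real
  assumes "b > \<bar>a\<bar>"
  shows "a\<^sup>2 < b\<^sup>2"
  using power_strict_mono[of "\<bar>a\<bar>" b 2] assms by simp

text \<open>
  The unnormalised density, with \<open>\<nu> = \<lambda> - 1 / 2\<close>; it is also the weight in the second integral of
  the Stein solution.
\<close>

definition gh_weight :: "real \<Rightarrow> real \<Rightarrow> real \<Rightarrow> real \<Rightarrow> real \<Rightarrow> real" where
  "gh_weight \<nu> \<alpha> \<beta> \<delta> t =
     exp (\<beta> * t) * (\<delta>\<^sup>2 + t\<^sup>2) powr (\<nu> / 2) * bessel_K \<nu> (\<alpha> * sqrt (t\<^sup>2 + \<delta>\<^sup>2))"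

text \<open>
  The normalising constant of the law. Its factors come from a Gaussian integral, from the translation
  by \<open>ln (\<alpha> \<delta> / \<gamma>)\<close> with \<open>\<gamma>\<^sup>2 = \<alpha>\<^sup>2 - \<beta>\<^sup>2\<close>, and from the Bessel integral that remains.
\<close>

definition gh_mass :: "real \<Rightarrow> real \<Rightarrow> real \<Rightarrow> real \<Rightarrow> real" where
  "gh_mass \<nu> \<alpha> \<beta> \<delta> = sqrt (2 * pi / \<alpha>) * (\<alpha> * \<delta> / sqrt (\<alpha>\<^sup>2 - \<beta>\<^sup>2)) powr (\<nu> + 1 / 2)
     * bessel_K (\<nu> + 1 / 2) (\<delta> * sqrt (\<alpha>\<^sup>2 - \<beta>\<^sup>2))"

lemma gh_mass_pos:
  assumes "\<delta> > 0" "\<alpha> > \<bar>\<beta>\<bar>"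
  shows "gh_mass \<nu> \<alpha> \<beta> \<delta> > 0"
proof -
  have "\<beta>\<^sup>2 < \<alpha>\<^sup>2" by (rule square_less_square_of_abs_less[OF assms(2)])
  then have "sqrt (\<alpha>\<^sup>2 - \<beta>\<^sup>2) > 0" by simp
  then show ?thesis unfolding gh_mass_def using assms
    by (intro mult_pos_pos bessel_K_pos) auto
qed

lemma gh_weight_pos:
  assumes "\<delta> > 0" "\<alpha> > \<bar>\<beta>\<bar>"
  shows "gh_weight \<nu> \<alpha> \<beta> \<delta> t > 0"
proof -
  have "t\<^sup>2 + \<delta>\<^sup>2 > 0" using assms by (simp add: add_nonneg_pos)
  then show ?thesis unfolding gh_weight_def using assms
    by (intro mult_pos_pos bessel_K_pos) (auto simp: add.commute)
qed

text \<open>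
  A generalised hyperbolic law is a normal mean-variance mixture. With \<open>r\<^sup>2 = \<delta>\<^sup>2 + t\<^sup>2\<close>,
  the weight \<open>r powr \<nu> * K(\<alpha> r)\<close> is half the integral of \<open>exp (\<nu> s - \<alpha> (exp s + r\<^sup>2 exp (- s)) / 2)\<close> over \<open>s\<close>,
  and for fixed \<open>s\<close> the integrand times \<open>exp (\<beta> t)\<close> is Gaussian in \<open>t\<close> with variance \<open>exp s / \<alpha>\<close>.
  Integrating over \<open>t\<close> first raises \<open>\<nu>\<close> to \<open>\<nu> + 1 / 2\<close>, replaces \<open>\<alpha>\<close> by \<open>(\<alpha>\<^sup>2 - \<beta>\<^sup>2) / \<alpha>\<close> in front of
  \<open>exp s\<close>, and leaves an integral of the same type.
\<close>

lemma nn_integral_gh_weight: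
  fixes \<nu> \<alpha> \<beta> \<delta> :: real
  assumes d: "\<delta> > 0" and ab: "\<alpha> > \<bar>\<beta>\<bar>"
  shows "(\<integral>\<^sup>+t. ennreal (gh_weight \<nu> \<alpha> \<beta> \<delta> t) \<partial>lborel) = ennreal (gh_mass \<nu> \<alpha> \<beta> \<delta>)"
proof -
  define \<gamma> where "\<gamma> = sqrt (\<alpha>\<^sup>2 - \<beta>\<^sup>2)"
  have a: "\<alpha> > 0" using ab by linarith
  have "\<beta>\<^sup>2 < \<alpha>\<^sup>2" by (rule square_less_square_of_abs_less[OF ab])
  then have g: "\<gamma> > 0" and g2: "\<gamma>\<^sup>2 = \<alpha>\<^sup>2 - \<beta>\<^sup>2" by (auto simp: \<gamma>_def)
  define G where "G = (\<lambda>t s. exp (\<beta> * t + \<nu> * s - \<alpha> * (exp s + (\<delta>\<^sup>2 + t\<^sup>2) * exp (- s)) / 2) / 2)"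
  have G_s: "(\<integral>\<^sup>+s. ennreal (G t s) \<partial>lborel) = ennreal (gh_weight \<nu> \<alpha> \<beta> \<delta> t)" for t
  proof -
    define r where "r = sqrt (\<delta>\<^sup>2 + t\<^sup>2)"
    have r0: "\<delta>\<^sup>2 + t\<^sup>2 > 0" using d by (simp add: add_pos_nonneg)
    then have r: "r > 0" "r\<^sup>2 = \<delta>\<^sup>2 + t\<^sup>2" by (auto simp: r_def)
    have z: "\<alpha> * r > 0" using a r by simp
    have e: "\<alpha> * r * (exp s / r + r * exp (- s)) / 2 = \<alpha> * (exp s + (\<delta>\<^sup>2 + t\<^sup>2) * exp (- s)) / 2" for s
    proof -
      have "r * (exp s / r + r * exp (- s)) = exp s + r\<^sup>2 * exp (- s)"
        using r(1) by (simp add: field_simps power2_eq_square)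
      then show ?thesis by (simp add: r(2) mult.assoc)
    qed
    have G: "G t s = exp (\<beta> * t) / 2 * exp (\<nu> * s - \<alpha> * r * (exp s / r + r * exp (- s)) / 2)" for s
      unfolding e G_def by (simp add: add_diff_eq flip: exp_add)
    have "(\<integral>s. G t s \<partial>lborel) = exp (\<beta> * t) * r powr \<nu> * bessel_K \<nu> (\<alpha> * r)"
      unfolding G using bessel_K_gig(2)[OF z r(1), of \<nu>] by simp
    also have "r powr \<nu> = (\<delta>\<^sup>2 + t\<^sup>2) powr (\<nu> / 2)"
      using r0 by (simp add: r_def powr_half_sqrt[symmetric] powr_powr)
    finally have "(\<integral>s. G t s \<partial>lborel) = gh_weight \<nu> \<alpha> \<beta> \<delta> t"
      by (simp add: gh_weight_def r_def add.commute)
    moreover have "integrable lborel (G t)"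
      unfolding G using bessel_K_gig(1)[OF z r(1), of \<nu>] by simp
    ultimately show ?thesis by (subst nn_integral_eq_integral) (auto simp: G_def)
  qed
  have G_t: "(\<integral>\<^sup>+t. ennreal (G t s) \<partial>lborel) = ennreal (sqrt (2 * pi / \<alpha>) / 2
     * exp ((\<nu> + 1 / 2) * s - (\<gamma> * \<delta>) * (exp s / (\<alpha> * \<delta> / \<gamma>) + (\<alpha> * \<delta> / \<gamma>) * exp (- s)) / 2))" (is "_ = ennreal ?R") for s
  proof -
    define v where "v = exp s / \<alpha>"
    have v: "v > 0" using a by (simp add: v_def)
    define c where "c = exp (\<nu> * s - \<alpha> * (exp s + \<delta>\<^sup>2 * exp (- s)) / 2) / 2"
    have c: "c \<ge> 0" by (simp add: c_def)
    have iv: "\<alpha> * exp (- s) = 1 / v" by (simp add: v_def exp_minus field_simps)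
    have "\<beta> * t + \<nu> * s - \<alpha> * (exp s + (\<delta>\<^sup>2 + t\<^sup>2) * exp (- s)) / 2
       = \<nu> * s - \<alpha> * (exp s + \<delta>\<^sup>2 * exp (- s)) / 2 + (\<beta> * t - t\<^sup>2 * (\<alpha> * exp (- s)) / 2)" for t
      by (simp add: algebra_simps add_divide_distrib)
    note eq = this[unfolded iv]
    have "G t s = c * exp (\<beta> * t - t\<^sup>2 / (2 * v))" for t
      unfolding G_def c_def eq exp_add by simp
    then have "(\<integral>\<^sup>+t. ennreal (G t s) \<partial>lborel) = (\<integral>\<^sup>+t. ennreal c * ennreal (exp (\<beta> * t - t\<^sup>2 / (2 * v))) \<partial>lborel)"
      using c by (simp add: ennreal_mult)
    also have "\<dots> = ennreal c * ennreal (sqrt (2 * pi * v) * exp (\<beta>\<^sup>2 * v / 2))"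
      by (subst nn_integral_cmult) (auto simp: nn_integral_gaussian_tilted[OF v])
    also have "\<dots> = ennreal (c * (sqrt (2 * pi * v) * exp (\<beta>\<^sup>2 * v / 2)))"
      using c by (simp add: ennreal_mult')
    also have "c * (sqrt (2 * pi * v) * exp (\<beta>\<^sup>2 * v / 2)) = ?R"
    proof -
      have "sqrt (exp s) = exp (s / 2)"
        by (rule real_sqrt_unique) (auto simp: power2_eq_square simp flip: exp_add)
      then have sv: "sqrt (2 * pi * v) = sqrt (2 * pi / \<alpha>) * exp (s / 2)"
        by (simp add: v_def real_sqrt_mult real_sqrt_divide)
      have x1: "\<gamma> * \<delta> * (exp s / (\<alpha> * \<delta> / \<gamma>) + \<alpha> * \<delta> / \<gamma> * exp (- s)) = (\<alpha>\<^sup>2 - \<beta>\<^sup>2) / \<alpha> * exp s + \<alpha> * \<delta>\<^sup>2 * exp (- s)"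
        unfolding g2[symmetric] using g a d by (simp add: field_simps power2_eq_square)
      have "\<nu> * s - \<alpha> * (exp s + \<delta>\<^sup>2 * exp (- s)) / 2 + s / 2 + \<beta>\<^sup>2 * v / 2
        = (\<nu> + 1 / 2) * s - (\<gamma> * \<delta>) * (exp s / (\<alpha> * \<delta> / \<gamma>) + (\<alpha> * \<delta> / \<gamma>) * exp (- s)) / 2"
        unfolding x1 using a by (simp add: v_def field_simps power2_eq_square)
      then show ?thesis unfolding sv c_def by (simp add: mult_ac flip: exp_add)
    qed
    finally show ?thesis .
  qed
  have zpos: "\<gamma> * \<delta> > 0" "\<alpha> * \<delta> / \<gamma> > 0" using g a d by auto
  have "(\<integral>\<^sup>+t. ennreal (gh_weight \<nu> \<alpha> \<beta> \<delta> t) \<partial>lborel) = (\<integral>\<^sup>+t. (\<integral>\<^sup>+s. ennreal (G t s) \<partial>lborel) \<partial>lborel)"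
    by (simp add: G_s)
  also have "\<dots> = (\<integral>\<^sup>+s. (\<integral>\<^sup>+t. ennreal (G t s) \<partial>lborel) \<partial>lborel)"
    by (rule lborel_pair.Fubini') (simp add: G_def)
  also have "\<dots> = ennreal (\<integral>s. sqrt (2 * pi / \<alpha>) / 2
     * exp ((\<nu> + 1 / 2) * s - (\<gamma> * \<delta>) * (exp s / (\<alpha> * \<delta> / \<gamma>) + (\<alpha> * \<delta> / \<gamma>) * exp (- s)) / 2) \<partial>lborel)"
    unfolding G_t using a bessel_K_gig(1)[OF zpos, of "\<nu> + 1 / 2"]
    by (intro nn_integral_eq_integral integrable_mult_right) auto
  also have "\<dots> = ennreal (gh_mass \<nu> \<alpha> \<beta> \<delta>)"
    using bessel_K_gig(2)[OF zpos, of "\<nu> + 1 / 2"]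
    by (simp add: gh_mass_def \<gamma>_def mult.assoc mult.commute[of "sqrt (\<alpha>\<^sup>2 - \<beta>\<^sup>2)" \<delta>])
  finally show ?thesis .
qed

lemma gh_density_eq:
  fixes lam \<alpha> \<beta> \<delta> x :: real
  assumes d: "\<delta> > 0" and ab: "\<alpha> > \<bar>\<beta>\<bar>"
  shows "gh_density lam \<alpha> \<beta> \<delta> x = gh_weight (lam - 1 / 2) \<alpha> \<beta> \<delta> x / gh_mass (lam - 1 / 2) \<alpha> \<beta> \<delta>"
proof -
  define g2 where "g2 = \<alpha>\<^sup>2 - \<beta>\<^sup>2"
  have a: "\<alpha> > 0" using ab by linarith
  have "\<beta>\<^sup>2 < \<alpha>\<^sup>2" by (rule square_less_square_of_abs_less[OF ab])
  then have g: "g2 > 0" by (simp add: g2_def)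
  define B where "B = bessel_K lam (\<delta> * sqrt g2)"
  have B: "B > 0" unfolding B_def using d g by (intro bessel_K_pos) auto
  have "gh_mass (lam - 1 / 2) \<alpha> \<beta> \<delta> = sqrt (2 * pi / \<alpha>) * (\<alpha> * \<delta> / sqrt g2) powr lam * B"
    by (simp add: gh_mass_def g2_def B_def)
  also have "\<dots> = sqrt (2 * pi) * \<alpha> powr (lam - 1 / 2) * \<delta> powr lam * B / g2 powr (lam / 2)"
  proof -
    have "sqrt g2 powr lam = g2 powr (lam / 2)"
      using g by (simp add: powr_half_sqrt[symmetric] powr_powr)
    moreover have "\<alpha> powr (lam - 1 / 2) = \<alpha> powr lam / sqrt \<alpha>"
      using a by (simp add: powr_diff powr_half_sqrt)
    ultimately show ?thesis
      using a d g by (simp add: real_sqrt_divide powr_divide powr_mult)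
  qed
  finally have "gh_mass (lam - 1 / 2) \<alpha> \<beta> \<delta> = \<dots>" .
  then show ?thesis
    by (simp add: gh_density_def gh_weight_def B_def[symmetric] g2_def[symmetric] add.commute)
qed

text \<open>
  Centring by the expectation kills the integral against the weight because the density integrates
  to one.
\<close>

lemma gh_centred_mean_zero:
  fixes lam \<alpha> \<beta> \<delta> :: real and h :: "real \<Rightarrow> real"
  assumes d: "\<delta> > 0" and ab: "\<alpha> > \<bar>\<beta>\<bar>"
    and h: "h \<in> borel_measurable borel" "bounded (range h)"
    and qm: "gh_weight (lam - 1 / 2) \<alpha> \<beta> \<delta> \<in> borel_measurable borel"
  shows "integrable lborel (gh_weight (lam - 1 / 2) \<alpha> \<beta> \<delta>)"
    and "(\<integral>t. gh_weight (lam - 1 / 2) \<alpha> \<beta> \<delta> t * gh_centred lam \<alpha> \<beta> \<delta> h t \<partial>lborel) = 0"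
proof -
  define q where "q = gh_weight (lam - 1 / 2) \<alpha> \<beta> \<delta>"
  define Z where "Z = gh_mass (lam - 1 / 2) \<alpha> \<beta> \<delta>"
  note [measurable] = h(1) qm[folded q_def]
  have Z: "Z > 0" unfolding Z_def by (rule gh_mass_pos[OF d ab])
  have q0: "q t \<ge> 0" for t unfolding q_def using gh_weight_pos[OF d ab] less_imp_le by blast
  have nn: "(\<integral>\<^sup>+t. ennreal (q t) \<partial>lborel) = ennreal Z"
    unfolding q_def Z_def by (rule nn_integral_gh_weight[OF d ab])
  then have qi: "integrable lborel q"
    using q0 by (intro integrableI_nonneg) auto
  then show "integrable lborel (gh_weight (lam - 1 / 2) \<alpha> \<beta> \<delta>)" by (simp add: q_def)
  have qZ: "(\<integral>t. q t \<partial>lborel) = Z"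
    using q0 nn Z by (subst integral_eq_nn_integral) auto
  obtain B where B: "\<And>t. \<bar>h t\<bar> \<le> B"
    using h(2) by (auto simp: bounded_iff)
  have B0: "B \<ge> 0" using B[of 0] by linarith
  have qh: "integrable lborel (\<lambda>t. q t * h t)"
    by (rule Bochner_Integration.integrable_bound[OF integrable_mult_right[OF qi, of B]])
       (auto simp: abs_mult mult.commute[of B] B0 intro!: mult_left_mono B)
  have "gh_expectation lam \<alpha> \<beta> \<delta> h = (\<integral>t. q t / Z * h t \<partial>lborel)"
    unfolding gh_expectation_def gh_distribution_def gh_density_eq[OF d ab] q_def[symmetric] Z_def[symmetric]
    using q0 Z by (subst integral_density) auto
  also have "\<dots> = (\<integral>t. q t * h t \<partial>lborel) / Z" by simp
  finally have E: "(\<integral>t. q t * h t \<partial>lborel) = gh_expectation lam \<alpha> \<beta> \<delta> h * Z" using Z by simp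
  have "(\<integral>t. q t * gh_centred lam \<alpha> \<beta> \<delta> h t \<partial>lborel)
      = (\<integral>t. q t * h t - q t * gh_expectation lam \<alpha> \<beta> \<delta> h \<partial>lborel)"
    by (simp add: gh_centred_def right_diff_distrib)
  also have "\<dots> = 0" using qh qi by (simp add: E qZ)
  finally show "(\<integral>t. gh_weight (lam - 1 / 2) \<alpha> \<beta> \<delta> t * gh_centred lam \<alpha> \<beta> \<delta> h t \<partial>lborel) = 0"
    by (simp add: q_def)
qed

section \<open>Variation of parameters with exponentially decaying kernels\<close>

lemma abs_interval_integral_le:
  fixes g G :: "real \<Rightarrow> real" and a b :: ereal
  assumes G: "integrable lborel G" "\<And>t. 0 \<le> G t"
    and le: "\<And>t. t \<in> einterval (min a b) (max a b) \<Longrightarrow> \<bar>g t\<bar> \<le> G t"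
  shows "\<bar>LBINT t=a..b. g t\<bar> \<le> (\<integral>t. G t \<partial>lborel)"
proof -
  have "\<bar>LBINT t=a..b. g t\<bar> = \<bar>\<integral>t. indicator (einterval (min a b) (max a b)) t * g t \<partial>lborel\<bar>"
    by (auto simp: interval_lebesgue_integral_def set_lebesgue_integral_def min_def max_def)
  also have "\<dots> \<le> (\<integral>t. \<bar>indicator (einterval (min a b) (max a b)) t * g t\<bar> \<partial>lborel)"
    by (rule integral_abs_bound)
  also have "\<dots> \<le> (\<integral>t. G t \<partial>lborel)"
    by (rule integral_mono'[OF G(1)]) (use G(2) le in \<open>auto simp: indicator_def\<close>)
  finally show ?thesis .
qed

text \<open>
  The exponential kernel is integrable with a mass that does not depend on \<open>x\<close>; hence bounds that are
  uniform in \<open>x\<close>.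
\<close>

lemma abs_convolution_le:
  fixes g k :: "real \<Rightarrow> real" and a b :: ereal and w x c C B :: real
  assumes c: "c > 0" and C: "C \<ge> 0"
    and g: "\<And>t. \<bar>g t\<bar> \<le> B"
    and k: "\<And>t. t \<in> einterval (min a b) (max a b) \<Longrightarrow> \<bar>w * k t\<bar> \<le> C * exp (- c * \<bar>x - t\<bar>)"
  shows "\<bar>w * (LBINT t=a..b. k t * g t)\<bar> \<le> C * (\<integral>t. exp (- c * \<bar>t\<bar>) \<partial>lborel) * B"
proof -
  have B: "B \<ge> 0" using g[of 0] by linarith
  have i: "integrable lborel (\<lambda>t. exp (- c * \<bar>t\<bar>))" by (rule integrable_exp_neg_abs[OF c])
  have i': "integrable lborel (\<lambda>t. exp (- c * \<bar>x - t\<bar>))"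
    using lborel_integrable_real_affine[OF i, of "-1" x] by simp
  have "(\<integral>t. exp (- c * \<bar>t\<bar>) \<partial>lborel) = (\<integral>t. exp (- c * \<bar>x - t\<bar>) \<partial>lborel)"
    using lborel_integral_real_affine[of "-1" "\<lambda>t. exp (- c * \<bar>t\<bar>)" x] by simp
  moreover have "\<bar>LBINT t=a..b. w * (k t * g t)\<bar> \<le> (\<integral>t. C * B * exp (- c * \<bar>x - t\<bar>) \<partial>lborel)"
  proof (rule abs_interval_integral_le)
    fix t assume "t \<in> einterval (min a b) (max a b)"
    then have "\<bar>w * k t\<bar> * \<bar>g t\<bar> \<le> C * exp (- c * \<bar>x - t\<bar>) * B"
      using k g C by (intro mult_mono) auto
    then show "\<bar>w * (k t * g t)\<bar> \<le> C * B * exp (- c * \<bar>x - t\<bar>)"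
      by (simp add: abs_mult mult_ac)
  qed (use i' C B in auto)
  ultimately show ?thesis by (simp add: mult_ac)
qed

text \<open>
  The analytic core. In \<open>f = - u P - v Q\<close> with \<open>P(x)\<close> the integral of \<open>p g\<close> over \<open>(0, x)\<close> and \<open>Q(x)\<close>
  that of \<open>q g\<close> over \<open>(x, \<infinity>)\<close>, the kernels are controlled only where \<open>t\<close> lies between \<open>0\<close> and \<open>x\<close>,
  respectively where \<open>x\<close> lies between \<open>0\<close> and \<open>t\<close>. For \<open>x < 0\<close> the range of \<open>Q\<close> leaves the second
  region, but the vanishing mean of \<open>g\<close> under \<open>q\<close> turns \<open>Q(x)\<close> into minus the integral over
  \<open>(-\<infinity>, x)\<close>, which stays inside it.

  The function \<open>g\<close> may be discontinuous everywhere, so \<open>P\<close> and \<open>Q\<close> need not be differentiable. Still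
  \<open>f\<close> is, with \<open>f' = - u' P - v' Q\<close>: near \<open>x\<close>, the part of \<open>f(y)\<close> that comes from the moving end points
  is the integral of \<open>(v(y) q(t) - u(y) p(t)) g(t)\<close> over \<open>(x, y)\<close>, whose kernel is continuous and
  vanishes at \<open>y = t = x\<close>; so it is \<open>o(y - x)\<close>.
\<close>

lemma variation_of_parameters_bound:
  fixes u v u' v' p q g :: "real \<Rightarrow> real" and c C B :: real
  assumes c: "c > 0" and C: "C \<ge> 0"
    and du: "\<And>x. (u has_real_derivative u' x) (at x)"
    and dv: "\<And>x. (v has_real_derivative v' x) (at x)"
    and p: "continuous_on UNIV p" and q: "continuous_on UNIV q"
    and cancel: "\<And>x. u x * p x = v x * q x"
    and up: "\<And>x t. 0 \<le> x * t \<Longrightarrow> \<bar>t\<bar> \<le> \<bar>x\<bar> \<Longrightarrow> \<bar>u x * p t\<bar> \<le> C * exp (- c * \<bar>x - t\<bar>)"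
    and u'p: "\<And>x t. 0 \<le> x * t \<Longrightarrow> \<bar>t\<bar> \<le> \<bar>x\<bar> \<Longrightarrow> \<bar>u' x * p t\<bar> \<le> C * exp (- c * \<bar>x - t\<bar>)"
    and vq: "\<And>x t. 0 \<le> x * t \<Longrightarrow> \<bar>x\<bar> \<le> \<bar>t\<bar> \<Longrightarrow> \<bar>v x * q t\<bar> \<le> C * exp (- c * \<bar>x - t\<bar>)"
    and v'q: "\<And>x t. 0 \<le> x * t \<Longrightarrow> \<bar>x\<bar> \<le> \<bar>t\<bar> \<Longrightarrow> \<bar>v' x * q t\<bar> \<le> C * exp (- c * \<bar>x - t\<bar>)"
    and g: "g \<in> borel_measurable borel" and B: "\<And>t. \<bar>g t\<bar> \<le> B"
    and qi: "integrable lborel q" and mean: "(\<integral>t. q t * g t \<partial>lborel) = 0"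
  defines "f \<equiv> \<lambda>x. - u x * (LBINT t=0..ereal x. p t * g t) - v x * (LBINT t=ereal x..\<infinity>. q t * g t)"
    and "K \<equiv> 2 * C * (\<integral>t. exp (- c * \<bar>t\<bar>) \<partial>lborel)"
  shows "\<bar>f x\<bar> \<le> K * B" and "\<exists>d. (f has_real_derivative d) (at x) \<and> \<bar>d\<bar> \<le> K * B"
proof -
  define P where "P = (\<lambda>x. LBINT t=0..ereal x. p t * g t)"
  define Q where "Q = (\<lambda>x. LBINT t=ereal x..\<infinity>. q t * g t)"
  have B0: "B \<ge> 0" using B[of 0] by linarith
  have pm [measurable]: "p \<in> borel_measurable borel" and qm [measurable]: "q \<in> borel_measurable borel"
    using p q by (auto intro: borel_measurable_continuous_onI)
  note g [measurable]
  have qg: "integrable lborel (\<lambda>t. q t * g t)"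
    by (rule Bochner_Integration.integrable_bound[OF integrable_mult_right[OF qi, of B]])
       (auto simp: abs_mult mult.commute[of B] B0 intro!: mult_left_mono B)
  have qg_int: "interval_lebesgue_integrable lborel a b (\<lambda>t. q t * g t)" for a b
    unfolding interval_lebesgue_integrable_def set_integrable_def
    using integrable_mult_indicator[OF _ qg] by auto
  have pg_int: "interval_lebesgue_integrable lborel (ereal a) (ereal b) (\<lambda>t. p t * g t)" for a b
  proof -
    have *: "set_integrable lborel {a<..<b} (\<lambda>t. p t * g t)" for a b :: real
    proof -
      have "set_integrable lborel {a..b} p"
        by (rule borel_integrable_atLeastAtMost') (use p continuous_on_subset in blast)
      then have "set_integrable lborel {a<..<b} p"
        by (rule set_integrable_subset) auto
      then have "integrable lborel (\<lambda>t. B * (indicator {a<..<b} t * p t))"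
        by (simp add: set_integrable_def)
      then show ?thesis unfolding set_integrable_def
        by (rule Bochner_Integration.integrable_bound)
           (auto simp: abs_mult indicator_def mult.commute[of B] B0 intro!: mult_left_mono B)
    qed
    show ?thesis unfolding interval_lebesgue_integrable_def using * by simp
  qed
  have P_split: "P y = P x + (LBINT t=ereal x..ereal y. p t * g t)" for x y
    unfolding P_def zero_ereal_def
    by (rule interval_integral_sum[symmetric]) (simp add: pg_int flip: ereal_min ereal_max)
  have Q_split: "Q y = Q x - (LBINT t=ereal x..ereal y. q t * g t)" for x y
    using interval_integral_sum[OF qg_int, of "ereal x" "ereal y" \<infinity>] by (simp add: Q_def)
  have Q_neg: "Q x = - (LBINT t=-\<infinity>..ereal x. q t * g t)" for x
    using interval_integral_sum[OF qg_int, of "-\<infinity>" "ereal x" \<infinity>] mean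
    by (simp add: Q_def interval_lebesgue_integral_def set_lebesgue_integral_def)
  have P_bound: "\<bar>w * P x\<bar> \<le> K / 2 * B"
    if "\<And>t. 0 \<le> x * t \<Longrightarrow> \<bar>t\<bar> \<le> \<bar>x\<bar> \<Longrightarrow> \<bar>w * p t\<bar> \<le> C * exp (- c * \<bar>x - t\<bar>)" for w x
  proof -
    have "\<bar>w * P x\<bar> \<le> C * (\<integral>t. exp (- c * \<bar>t\<bar>) \<partial>lborel) * B"
      unfolding P_def
    proof (rule abs_convolution_le[OF c C B, where x = x])
      fix t assume "t \<in> einterval (min 0 (ereal x)) (max 0 (ereal x))"
      then show "\<bar>w * p t\<bar> \<le> C * exp (- c * \<bar>x - t\<bar>)"
        by (intro that) (auto simp: einterval_iff min_def max_def zero_le_mult_iff zero_ereal_def split: if_splits)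
    qed
    then show ?thesis by (simp add: K_def)
  qed
  have Q_bound: "\<bar>w * Q x\<bar> \<le> K / 2 * B"
    if "\<And>t. 0 \<le> x * t \<Longrightarrow> \<bar>x\<bar> \<le> \<bar>t\<bar> \<Longrightarrow> \<bar>w * q t\<bar> \<le> C * exp (- c * \<bar>x - t\<bar>)" for w x
  proof (cases "x \<ge> 0")
    case True
    have "\<bar>w * Q x\<bar> \<le> C * (\<integral>t. exp (- c * \<bar>t\<bar>) \<partial>lborel) * B"
      unfolding Q_def
    proof (rule abs_convolution_le[OF c C B, where x = x])
      fix t assume "t \<in> einterval (min (ereal x) \<infinity>) (max (ereal x) \<infinity>)"
      then show "\<bar>w * q t\<bar> \<le> C * exp (- c * \<bar>x - t\<bar>)"
        using True by (intro that) (auto simp: einterval_iff)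
    qed
    then show ?thesis by (simp add: K_def)
  next
    case False
    have "\<bar>w * (LBINT t=-\<infinity>..ereal x. q t * g t)\<bar> \<le> C * (\<integral>t. exp (- c * \<bar>t\<bar>) \<partial>lborel) * B"
    proof (rule abs_convolution_le[OF c C B, where x = x])
      fix t assume "t \<in> einterval (min (-\<infinity>) (ereal x)) (max (-\<infinity>) (ereal x))"
      then show "\<bar>w * q t\<bar> \<le> C * exp (- c * \<bar>x - t\<bar>)"
        using False by (intro that) (auto simp: einterval_iff zero_le_mult_iff)
    qed
    then show ?thesis by (simp add: K_def Q_neg)
  qed
  have fPQ: "f x = - (u x * P x) - v x * Q x" for x
    by (simp add: f_def P_def Q_def)
  have halves: "K / 2 * B = K * B / 2" by simp
  show "\<bar>f x\<bar> \<le> K * B"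
    using P_bound[of x "u x", OF up] Q_bound[of x "v x", OF vq]
    unfolding fPQ halves by linarith
  define d where "d = - (u' x * P x) - v' x * Q x"
  have "\<bar>d\<bar> \<le> K * B"
    using P_bound[of x "u' x", OF u'p] Q_bound[of x "v' x", OF v'q]
    unfolding d_def halves by linarith
  moreover have "(f has_real_derivative d) (at x)"
  proof -
    \<comment> \<open>\<open>F1\<close> freezes the integrals at \<open>x\<close>; \<open>F2\<close> collects the effect of moving their end points.\<close>
    define F1 where "F1 = (\<lambda>y. - u y * P x - v y * Q x)"
    define F2 where "F2 = (\<lambda>y. LBINT t=ereal x..ereal y. (v y * q t - u y * p t) * g t)"
    have f: "f y = F1 y + F2 y" for y
    proof -
      have "F2 y = (LBINT t=ereal x..ereal y. v y * (q t * g t) - u y * (p t * g t))"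
        unfolding F2_def by (simp add: algebra_simps)
      also have "\<dots> = v y * (LBINT t=ereal x..ereal y. q t * g t) - u y * (LBINT t=ereal x..ereal y. p t * g t)"
        by (simp add: qg_int pg_int)
      finally show ?thesis
        unfolding fPQ F1_def P_split[where y = y and x = x] Q_split[where y = y and x = x]
        by (simp add: algebra_simps)
    qed
    have d1: "(F1 has_real_derivative d) (at x)"
      unfolding F1_def d_def by (auto intro!: derivative_eq_intros du dv)
    have d2: "(F2 has_real_derivative 0) (at x)"
    proof (rule has_real_derivativeI_remainder)
      fix e :: real assume e: "e > 0"
      define k where "k = (\<lambda>z. v (fst z) * q (snd z) - u (fst z) * p (snd z))"
      have uc: "continuous_on UNIV u" and vc: "continuous_on UNIV v"
        using DERIV_isCont[OF du] DERIV_isCont[OF dv]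
        by (simp_all add: continuous_at_imp_continuous_on)
      have "continuous_on UNIV k" unfolding k_def
        by (intro continuous_intros continuous_on_compose2[OF uc] continuous_on_compose2[OF vc]
            continuous_on_compose2[OF p] continuous_on_compose2[OF q]) auto
      then have "isCont k (x, x)" by (simp add: continuous_on_eq_continuous_at)
      moreover have "k (x, x) = 0" using cancel[of x] by (simp add: k_def)
      moreover have "e / (B + 1) > 0" using e B0 by simp
      ultimately obtain s where s: "s > 0" "\<And>z. dist z (x, x) < s \<Longrightarrow> \<bar>k z\<bar> < e / (B + 1)"
        unfolding continuous_at_eps_delta by (metis dist_real_def diff_zero)
      have "\<bar>F2 y\<bar> \<le> e * \<bar>y - x\<bar>" if y: "\<bar>y - x\<bar> < s / 2" for y
      proof -
        define J where "J = {min x y..max x y}"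
        have "\<bar>F2 y\<bar> \<le> (\<integral>t. e * indicator J t \<partial>lborel)"
          unfolding F2_def
        proof (rule abs_interval_integral_le)
          fix t assume "t \<in> einterval (min (ereal x) (ereal y)) (max (ereal x) (ereal y))"
          then have t: "min x y < t" "t < max x y" by (auto simp: einterval_iff simp flip: ereal_min ereal_max)
          then have "\<bar>t - x\<bar> < s / 2" using y by (auto simp: min_def max_def split: if_splits)
          then have "dist (y, t) (x, x) < s"
            using y sqrt_sum_squares_half_less[of "\<bar>y - x\<bar>" s "\<bar>t - x\<bar>"]
            by (simp add: dist_Pair_Pair dist_real_def)
          then have "\<bar>k (y, t)\<bar> \<le> e / (B + 1)" using s(2) less_imp_le by blast
          then have "\<bar>k (y, t)\<bar> * \<bar>g t\<bar> \<le> e / (B + 1) * (B + 1)"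
            using B[of t] e B0 by (intro mult_mono) auto
          then show "\<bar>(v y * q t - u y * p t) * g t\<bar> \<le> e * indicator J t"
            using t B0 by (simp add: k_def J_def abs_mult)
        qed (use e in \<open>auto simp: J_def\<close>)
        also have "\<dots> = e * \<bar>y - x\<bar>" by (auto simp: J_def min_def max_def)
        finally show ?thesis .
      qed
      then show "\<exists>d>0. \<forall>y. \<bar>y - x\<bar> < d \<longrightarrow> \<bar>F2 y - F2 x - 0 * (y - x)\<bar> \<le> e * \<bar>y - x\<bar>"
        using s(1) by (intro exI[of _ "s / 2"]) (simp add: F2_def)
    qed
    have "f = (\<lambda>y. F1 y + F2 y)" using f by (rule ext)
    then show ?thesis using DERIV_add[OF d1 d2] by simp
  qed
  ultimately show "\<exists>d. (f has_real_derivative d) (at x) \<and> \<bar>d\<bar> \<le> K * B" by blast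
qed

section \<open>The gauge and the radius\<close>

definition gh_radius :: "real \<Rightarrow> real \<Rightarrow> real" where
  "gh_radius \<delta> x = sqrt (\<delta>\<^sup>2 + x\<^sup>2)"

text \<open>
  The prefactor \<open>exp (- \<beta> x) r(x) powr (- \<nu>)\<close> of the solution, written as a single exponential so that
  ratios are estimated by adding exponents; its reciprocal is the weight inside the integrals.
\<close>

definition gh_gauge :: "real \<Rightarrow> real \<Rightarrow> real \<Rightarrow> real \<Rightarrow> real" where
  "gh_gauge \<nu> \<beta> \<delta> x = exp (- \<beta> * x - \<nu> * ln (gh_radius \<delta> x))"

lemma gh_radius_ge:
  assumes "\<delta> > 0"
  shows "\<delta> \<le> gh_radius \<delta> x" "\<bar>x\<bar> \<le> gh_radius \<delta> x" "gh_radius \<delta> x \<le> \<delta> + \<bar>x\<bar>" "gh_radius \<delta> x > 0"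
proof -
  show 1: "\<delta> \<le> gh_radius \<delta> x" unfolding gh_radius_def by (rule real_le_rsqrt) simp
  show "\<bar>x\<bar> \<le> gh_radius \<delta> x" unfolding gh_radius_def by (rule real_le_rsqrt) simp
  show "gh_radius \<delta> x \<le> \<delta> + \<bar>x\<bar>"
    unfolding gh_radius_def using sqrt_sum_squares_le_sum_abs[of \<delta> x] assms by simp
  show "gh_radius \<delta> x > 0" using 1 assms by simp
qed

lemma gh_radius_lipschitz: "gh_radius \<delta> x \<le> gh_radius \<delta> t + \<bar>x - t\<bar>"
  using real_sqrt_sum_squares_triangle_ineq[of \<delta> 0 t "x - t"] by (simp add: gh_radius_def)

text \<open>
  On each side of the origin the radius grows like \<open>\<bar>x\<bar>\<close> up to the constant \<open>\<delta>\<close>. This is what makes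
  \<open>exp (- \<alpha> r)\<close> decay in the distance \<open>\<bar>t - s\<bar>\<close>.
\<close>

lemma gh_radius_growth:
  assumes d: "\<delta> > 0" and "0 \<le> s * t" "\<bar>s\<bar> \<le> \<bar>t\<bar>"
  shows "\<bar>t - s\<bar> - \<delta> \<le> gh_radius \<delta> t - gh_radius \<delta> s"
proof -
  have "\<bar>t - s\<bar> = \<bar>t\<bar> - \<bar>s\<bar>" using assms(2,3) by (auto simp: zero_le_mult_iff)
  then show ?thesis using gh_radius_ge(2)[OF d, of t] gh_radius_ge(3)[OF d, of s] by linarith
qed

lemma gh_radius_deriv:
  assumes "\<delta> > 0"
  shows "(gh_radius \<delta> has_real_derivative x / gh_radius \<delta> x) (at x)"
proof -
  have "\<delta>\<^sup>2 + x\<^sup>2 > 0" using assms by (simp add: add_pos_nonneg)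
  then show ?thesis unfolding gh_radius_def
    by (auto intro!: derivative_eq_intros simp: field_simps)
qed

lemma gh_gauge_eq:
  assumes "\<delta> > 0"
  shows "gh_gauge \<nu> \<beta> \<delta> x = exp (- \<beta> * x) / (\<delta>\<^sup>2 + x\<^sup>2) powr (\<nu> / 2)"
proof -
  have "\<delta>\<^sup>2 + x\<^sup>2 > 0" using assms by (simp add: add_pos_nonneg)
  then show ?thesis using assms by (simp add: gh_gauge_def gh_radius_def powr_def ln_sqrt exp_diff)
qed

lemma gh_gauge_pos: "gh_gauge \<nu> \<beta> \<delta> x > 0"
  by (simp add: gh_gauge_def)

lemma gh_gauge_deriv:
  assumes d: "\<delta> > 0"
  shows "(gh_gauge \<nu> \<beta> \<delta> has_real_derivative
     gh_gauge \<nu> \<beta> \<delta> x * (- \<beta> - \<nu> * (x / gh_radius \<delta> x) / gh_radius \<delta> x)) (at x)"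
  unfolding gh_gauge_def
  by (auto intro!: derivative_eq_intros gh_radius_deriv[OF d] simp: gh_radius_ge(4)[OF d])

text \<open>
  The radius is 1-Lipschitz and at least \<open>\<delta>\<close>, so \<open>r(y) \<le> r(z) (1 + \<bar>y - z\<bar> / \<delta>)\<close>. Up to the polynomial
  factor this costs, the gauge varies at the rate \<open>\<bar>\<beta>\<bar> < \<alpha>\<close>.
\<close>

lemma gh_gauge_ratio:
  assumes d: "\<delta> > 0"
  shows "gh_gauge \<nu> \<beta> \<delta> x / gh_gauge \<nu> \<beta> \<delta> t \<le> exp (\<bar>\<beta>\<bar> * \<bar>x - t\<bar> + \<bar>\<nu>\<bar> * ln (1 + \<bar>x - t\<bar> / \<delta>))"
proof -
  have half: "ln (gh_radius \<delta> y) \<le> ln (gh_radius \<delta> z) + ln (1 + \<bar>y - z\<bar> / \<delta>)" for y z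
  proof -
    note r = gh_radius_ge[OF d, of z]
    have "\<bar>y - z\<bar> \<le> gh_radius \<delta> z * (\<bar>y - z\<bar> / \<delta>)"
      using r(1) d mult_right_mono[of \<delta> "gh_radius \<delta> z" "\<bar>y - z\<bar> / \<delta>"] by simp
    then have "gh_radius \<delta> y \<le> gh_radius \<delta> z * (1 + \<bar>y - z\<bar> / \<delta>)"
      using gh_radius_lipschitz[of \<delta> y z] by (simp add: distrib_left)
    moreover have "1 + \<bar>y - z\<bar> / \<delta> > 0" using d by (simp add: add_pos_nonneg)
    ultimately show ?thesis
      using r(4) gh_radius_ge(4)[OF d, of y] by (simp add: ln_mult_pos[symmetric] ln_le_cancel_iff)
  qed
  have "\<bar>ln (gh_radius \<delta> t) - ln (gh_radius \<delta> x)\<bar> \<le> ln (1 + \<bar>x - t\<bar> / \<delta>)"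
    using half[of x t] half[of t x] by (simp add: abs_minus_commute abs_le_iff)
  then have "\<bar>\<nu>\<bar> * \<bar>ln (gh_radius \<delta> t) - ln (gh_radius \<delta> x)\<bar> \<le> \<bar>\<nu>\<bar> * ln (1 + \<bar>x - t\<bar> / \<delta>)"
    by (intro mult_left_mono) auto
  moreover have "\<nu> * (ln (gh_radius \<delta> t) - ln (gh_radius \<delta> x)) \<le> \<bar>\<nu>\<bar> * \<bar>ln (gh_radius \<delta> t) - ln (gh_radius \<delta> x)\<bar>"
    by (metis abs_ge_self abs_mult)
  moreover have "- \<beta> * (x - t) \<le> \<bar>\<beta>\<bar> * \<bar>x - t\<bar>"
    by (metis abs_ge_self abs_mult abs_minus_cancel)
  ultimately have "- \<beta> * (x - t) + \<nu> * (ln (gh_radius \<delta> t) - ln (gh_radius \<delta> x))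
      \<le> \<bar>\<beta>\<bar> * \<bar>x - t\<bar> + \<bar>\<nu>\<bar> * ln (1 + \<bar>x - t\<bar> / \<delta>)" by linarith
  moreover have "gh_gauge \<nu> \<beta> \<delta> x / gh_gauge \<nu> \<beta> \<delta> t
      = exp (- \<beta> * (x - t) + \<nu> * (ln (gh_radius \<delta> t) - ln (gh_radius \<delta> x)))"
    by (simp add: gh_gauge_def algebra_simps flip: exp_diff)
  ultimately show ?thesis by simp
qed

text \<open>
  A polynomial factor is absorbed by an arbitrarily slow exponential: apply \<open>ln z \<le> z - 1\<close> to
  \<open>\<eta> (1 + s / \<delta>)\<close>.
\<close>

lemma ln_le_linear:
  fixes a \<epsilon> :: real
  assumes d: "\<delta> > 0" and e: "\<epsilon> > 0" and a: "a \<ge> 0"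
  obtains M where "\<And>s. s \<ge> 0 \<Longrightarrow> a * ln (1 + s / \<delta>) \<le> M + \<epsilon> * s"
proof -
  \<comment> \<open>Chosen such that \<open>(a + 1) \<eta> / \<delta> = \<epsilon>\<close>; the shift by one covers \<open>a = 0\<close>.\<close>
  define \<eta> where "\<eta> = \<epsilon> * \<delta> / (a + 1)"
  have eta: "\<eta> > 0" using assms by (simp add: \<eta>_def)
  show thesis
  proof (rule that[of "(a + 1) * (\<eta> - 1 - ln \<eta>)"])
    fix s :: real assume s: "s \<ge> 0"
    have z: "1 + s / \<delta> \<ge> 1" using d s by simp
    have "ln (\<eta> * (1 + s / \<delta>)) \<le> \<eta> * (1 + s / \<delta>) - 1"
      using eta z by (intro ln_le_minus_one) auto
    then have "ln (1 + s / \<delta>) \<le> \<eta> * (1 + s / \<delta>) - 1 - ln \<eta>"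
      using eta z by (simp add: ln_mult_pos)
    then have "(a + 1) * ln (1 + s / \<delta>) \<le> (a + 1) * (\<eta> * (1 + s / \<delta>) - 1 - ln \<eta>)"
      using a by (intro mult_left_mono) auto
    also have "\<dots> = (a + 1) * (\<eta> - 1 - ln \<eta>) + (a + 1) * \<eta> * s / \<delta>" by (simp add: algebra_simps)
    also have "(a + 1) * \<eta> * s / \<delta> = \<epsilon> * s" using a d by (simp add: \<eta>_def)
    finally show "a * ln (1 + s / \<delta>) \<le> (a + 1) * (\<eta> - 1 - ln \<eta>) + \<epsilon> * s"
      using ln_ge_zero[OF z] by (simp add: distrib_right)
  qed
qed

text \<open>
  Applied with \<open>Z = K\<close>, \<open>\<sigma> = - 1\<close> and with \<open>Z = I\<close>, \<open>\<sigma> = 1\<close>. Differentiating costs only a constant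
  factor, because the logarithmic derivative of the gauge and the slope \<open>x / r\<close> of the radius are
  bounded on the whole line.
\<close>

lemma gauged_radial_derivative:
  fixes Z Z' :: "real \<Rightarrow> real" and \<alpha> \<beta> \<delta> \<nu> \<sigma> C :: real
  assumes d: "\<delta> > 0" and a: "\<alpha> > 0" and C: "C \<ge> 0"
    and dZ: "\<And>y. y > 0 \<Longrightarrow> (Z has_real_derivative Z' y) (at y)"
    and Z: "\<And>y. y \<ge> \<alpha> * \<delta> \<Longrightarrow> \<bar>Z y\<bar> \<le> C * exp (\<sigma> * y)"
    and Z': "\<And>y. y \<ge> \<alpha> * \<delta> \<Longrightarrow> \<bar>Z' y\<bar> \<le> C * exp (\<sigma> * y)"
  defines "w \<equiv> \<lambda>x. gh_gauge \<nu> \<beta> \<delta> x * Z (\<alpha> * gh_radius \<delta> x)"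
  obtains w' where "\<And>x. (w has_real_derivative w' x) (at x)"
    "\<And>x. \<bar>w x\<bar> \<le> (1 + \<bar>\<beta>\<bar> + \<bar>\<nu>\<bar> / \<delta> + \<alpha>) * C * gh_gauge \<nu> \<beta> \<delta> x * exp (\<sigma> * (\<alpha> * gh_radius \<delta> x))"
    "\<And>x. \<bar>w' x\<bar> \<le> (1 + \<bar>\<beta>\<bar> + \<bar>\<nu>\<bar> / \<delta> + \<alpha>) * C * gh_gauge \<nu> \<beta> \<delta> x * exp (\<sigma> * (\<alpha> * gh_radius \<delta> x))"
proof -
  define r where "r = gh_radius \<delta>"
  define W where "W = gh_gauge \<nu> \<beta> \<delta>"
  define A where "A = 1 + \<bar>\<beta>\<bar> + \<bar>\<nu>\<bar> / \<delta> + \<alpha>"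
  define w' where "w' = (\<lambda>x. W x * (- \<beta> - \<nu> * (x / r x) / r x) * Z (\<alpha> * r x) + Z' (\<alpha> * r x) * (\<alpha> * (x / r x)) * W x)"
  have r: "r x > 0" "\<delta> \<le> r x" "\<bar>x / r x\<bar> \<le> 1" for x
    using gh_radius_ge[OF d, of x] by (auto simp: r_def)
  have W: "W x > 0" for x by (simp add: W_def gh_gauge_pos)
  have A: "A \<ge> 1" "A \<ge> \<bar>\<beta>\<bar> + \<bar>\<nu>\<bar> / \<delta> + \<alpha>" using d a by (simp_all add: A_def)
  have far: "\<alpha> * r x \<ge> \<alpha> * \<delta>" for x using r(2)[of x] a by simp
  show thesis
  proof (rule that)
    fix x
    define e where "e = exp (\<sigma> * (\<alpha> * r x))"
    have wx: "w x = W x * Z (\<alpha> * r x)" by (simp add: w_def W_def r_def)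
    have dR: "((\<lambda>x. \<alpha> * r x) has_real_derivative \<alpha> * (x / r x)) (at x)"
      unfolding r_def by (rule DERIV_cmult[OF gh_radius_deriv[OF d]])
    have dZr: "((\<lambda>x. Z (\<alpha> * r x)) has_real_derivative Z' (\<alpha> * r x) * (\<alpha> * (x / r x))) (at x)"
      by (rule DERIV_chain2[OF dZ dR]) (use r(1)[of x] a in simp)
    show "(w has_real_derivative w' x) (at x)"
      using DERIV_mult[OF gh_gauge_deriv[OF d, of \<nu> \<beta> x] dZr] unfolding w_def w'_def W_def r_def .
    have z: "\<bar>Z (\<alpha> * r x)\<bar> \<le> C * e" "\<bar>Z' (\<alpha> * r x)\<bar> \<le> C * e"
      using Z[OF far] Z'[OF far] by (simp_all add: e_def)
    have e0: "C * e \<ge> 0" using C by (simp add: e_def)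
    have "\<bar>w x\<bar> \<le> W x * (C * e)" using z(1) W[of x] by (simp add: wx abs_mult)
    also have "\<dots> \<le> A * (W x * (C * e))" using A(1) W[of x] e0 mult_right_mono[of 1 A "W x * (C * e)"] by simp
    finally show "\<bar>w x\<bar> \<le> (1 + \<bar>\<beta>\<bar> + \<bar>\<nu>\<bar> / \<delta> + \<alpha>) * C * gh_gauge \<nu> \<beta> \<delta> x * exp (\<sigma> * (\<alpha> * gh_radius \<delta> x))"
      by (simp add: A_def W_def e_def r_def mult_ac)
    have "\<bar>\<nu> * (x / r x) / r x\<bar> \<le> \<bar>\<nu>\<bar> * 1 / \<delta>"
      unfolding abs_divide abs_mult using r[of x] d
      by (intro frac_le mult_left_mono) (auto simp: abs_divide)
    then have "\<bar>- \<beta> - \<nu> * (x / r x) / r x\<bar> \<le> \<bar>\<beta>\<bar> + \<bar>\<nu>\<bar> / \<delta>" by linarith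
    then have t1: "\<bar>- \<beta> - \<nu> * (x / r x) / r x\<bar> * \<bar>Z (\<alpha> * r x)\<bar> \<le> (\<bar>\<beta>\<bar> + \<bar>\<nu>\<bar> / \<delta>) * (C * e)"
      using z(1) e0 d by (intro mult_mono) auto
    have t2: "\<bar>Z' (\<alpha> * r x)\<bar> * (\<alpha> * \<bar>x / r x\<bar>) \<le> (C * e) * (\<alpha> * 1)"
      using z(2) e0 a r(3)[of x] by (intro mult_mono mult_left_mono) auto
    have "w' x = W x * ((- \<beta> - \<nu> * (x / r x) / r x) * Z (\<alpha> * r x) + Z' (\<alpha> * r x) * (\<alpha> * (x / r x)))"
      by (simp add: w'_def algebra_simps)
    then have "\<bar>w' x\<bar> = W x * \<bar>(- \<beta> - \<nu> * (x / r x) / r x) * Z (\<alpha> * r x) + Z' (\<alpha> * r x) * (\<alpha> * (x / r x))\<bar>"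
      using W[of x] by (simp add: abs_mult)
    also have "\<dots> \<le> W x * (\<bar>- \<beta> - \<nu> * (x / r x) / r x\<bar> * \<bar>Z (\<alpha> * r x)\<bar> + \<bar>Z' (\<alpha> * r x)\<bar> * (\<alpha> * \<bar>x / r x\<bar>))"
      using W[of x] a by (intro mult_left_mono order_trans[OF abs_triangle_ineq]) (auto simp: abs_mult)
    also have "\<dots> \<le> W x * (A * (C * e))"
    proof (rule mult_left_mono)
      have "(\<bar>\<beta>\<bar> + \<bar>\<nu>\<bar> / \<delta>) * (C * e) + (C * e) * (\<alpha> * 1) = (\<bar>\<beta>\<bar> + \<bar>\<nu>\<bar> / \<delta> + \<alpha>) * (C * e)"
        by (simp add: algebra_simps)
      also have "\<dots> \<le> A * (C * e)" using A(2) e0 by (intro mult_right_mono) auto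
      finally show "\<bar>- \<beta> - \<nu> * (x / r x) / r x\<bar> * \<bar>Z (\<alpha> * r x)\<bar> + \<bar>Z' (\<alpha> * r x)\<bar> * (\<alpha> * \<bar>x / r x\<bar>) \<le> A * (C * e)"
        using t1 t2 by linarith
    qed (use W[of x] in simp)
    finally show "\<bar>w' x\<bar> \<le> (1 + \<bar>\<beta>\<bar> + \<bar>\<nu>\<bar> / \<delta> + \<alpha>) * C * gh_gauge \<nu> \<beta> \<delta> x * exp (\<sigma> * (\<alpha> * gh_radius \<delta> x))"
      by (simp add: A_def W_def e_def r_def mult_ac)
  qed
qed

section \<open>Uniform bounds for the Stein solution\<close>

lemma sup_norm_leI:
  assumes "\<And>x. \<bar>f x\<bar> \<le> c"
  shows "sup_norm f \<le> ennreal c"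
  unfolding sup_norm_def using assms by (intro SUP_least ennreal_leI) auto

lemma sup_norm_bounded:
  assumes "bounded (range g)"
  obtains B where "B \<ge> 0" "sup_norm g = ennreal B" "\<And>x. \<bar>g x\<bar> \<le> B"
proof -
  obtain b where "\<And>x. \<bar>g x\<bar> \<le> b" using assms by (auto simp: bounded_iff)
  then have "sup_norm g \<le> ennreal b" by (rule sup_norm_leI)
  then have "sup_norm g \<noteq> \<infinity>" by (auto simp: top_unique)
  then obtain B where B: "B \<ge> 0" "sup_norm g = ennreal B" by (cases "sup_norm g") auto
  moreover have "\<bar>g x\<bar> \<le> B" for x
  proof -
    have "ennreal \<bar>g x\<bar> \<le> sup_norm g" unfolding sup_norm_def by (rule SUP_upper) simp
    then show ?thesis using B by simp
  qed
  ultimately show thesis by (rule that)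
qed

theorem lemma3p5:
  fixes lam \<alpha> \<beta> \<delta> :: real
  assumes "\<delta> > 0" and "\<alpha> > \<bar>\<beta>\<bar>"
  shows "\<exists>C0\<ge>0. \<exists>C1\<ge>0. \<forall>h :: real \<Rightarrow> real. h \<in> borel_measurable borel \<longrightarrow> bounded (range h) \<longrightarrow>
    sup_norm (gh_stein_solution lam \<alpha> \<beta> \<delta> h) \<le> ennreal C0 * sup_norm (gh_centred lam \<alpha> \<beta> \<delta> h) \<and>
    (\<forall>x. gh_stein_solution lam \<alpha> \<beta> \<delta> h differentiable (at x)) \<and>
    sup_norm (deriv (gh_stein_solution lam \<alpha> \<beta> \<delta> h)) \<le> ennreal C1 * sup_norm (gh_centred lam \<alpha> \<beta> \<delta> h)"
proof -
  define \<nu> where "\<nu> = lam - 1 / 2"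
  note d = assms(1)
  have a: "\<alpha> > 0" using assms(2) by linarith
  define r where "r = gh_radius \<delta>"
  define W where "W = gh_gauge \<nu> \<beta> \<delta>"
  \<comment> \<open>Half of the gap between the rates \<open>\<alpha>\<close> of the Bessel functions and \<open>\<bar>\<beta>\<bar>\<close> of the gauge; the other
    half pays for the polynomial factor \<open>(1 + \<bar>x - t\<bar> / \<delta>) powr \<bar>\<nu>\<bar>\<close>.\<close>
  define c where "c = (\<alpha> - \<bar>\<beta>\<bar>) / 2"
  have c: "c > 0" using assms(2) by (simp add: c_def)
  \<comment> \<open>The Bessel functions are only evaluated at \<open>\<alpha> r(x) \<ge> \<alpha> \<delta>\<close>, away from their singularity at zero.\<close>
  have x0: "\<alpha> * \<delta> > 0" using a d by simp
  have W: "W x > 0" for x by (simp add: W_def gh_gauge_pos)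
  have far: "\<alpha> * r x \<ge> \<alpha> * \<delta>" for x using gh_radius_ge(1)[OF d, of x] a by (simp add: r_def)
  define u where "u = (\<lambda>x. W x * bessel_K \<nu> (\<alpha> * r x))"
  define v where "v = (\<lambda>x. W x * bessel_I \<nu> (\<alpha> * r x))"
  define p where "p = (\<lambda>t. bessel_I \<nu> (\<alpha> * r t) / W t)"
  define q where "q = (\<lambda>t. bessel_K \<nu> (\<alpha> * r t) / W t)"
  define A where "A = 1 + \<bar>\<beta>\<bar> + \<bar>\<nu>\<bar> / \<delta> + \<alpha>"
  have A: "A \<ge> 1" using d a by (simp add: A_def)
  obtain I' where dI: "\<And>x. x > 0 \<Longrightarrow> (bessel_I \<nu> has_real_derivative I' x) (at x)"
    and dI': "\<And>x. x > 0 \<Longrightarrow> (I' has_real_derivative (1 + \<nu>\<^sup>2 / x\<^sup>2) * bessel_I \<nu> x - I' x / x) (at x)"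
    using bessel_I_ode[of \<nu>] by blast
  have pos: "y > 0" if "y \<ge> \<alpha> * \<delta>" for y using that x0 by linarith
  obtain CI where CI: "CI \<ge> 0" "\<And>x. x \<ge> \<alpha> * \<delta> \<Longrightarrow> \<bar>bessel_I \<nu> x\<bar> \<le> CI * exp (1 * x)"
    "\<And>x. x \<ge> \<alpha> * \<delta> \<Longrightarrow> \<bar>I' x\<bar> \<le> CI * exp (1 * x)"
    using modified_bessel_ode_growth[OF x0 dI[OF pos] dI'[OF pos]] unfolding mult_1 by blast
  obtain CK where CK: "CK \<ge> 0" "\<And>x. x \<ge> \<alpha> * \<delta> \<Longrightarrow> \<bar>bessel_K \<nu> x\<bar> \<le> CK * exp (- 1 * x)"
    "\<And>x. x \<ge> \<alpha> * \<delta> \<Longrightarrow> \<bar>- bessel_K_slope \<nu> x\<bar> \<le> CK * exp (- 1 * x)"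
    using bessel_K_decay[OF x0, of \<nu>] unfolding mult_minus1 abs_minus_cancel by blast
  obtain u' where du: "\<And>x. (u has_real_derivative u' x) (at x)"
    and u: "\<And>x. \<bar>u x\<bar> \<le> A * CK * W x * exp (- 1 * (\<alpha> * r x))"
    and u': "\<And>x. \<bar>u' x\<bar> \<le> A * CK * W x * exp (- 1 * (\<alpha> * r x))"
    using gauged_radial_derivative[OF d a CK(1) bessel_K_has_derivative CK(2,3), of \<nu> \<beta>]
    unfolding u_def r_def W_def A_def by blast
  obtain v' where dv: "\<And>x. (v has_real_derivative v' x) (at x)"
    and v: "\<And>x. \<bar>v x\<bar> \<le> A * CI * W x * exp (1 * (\<alpha> * r x))"
    and v': "\<And>x. \<bar>v' x\<bar> \<le> A * CI * W x * exp (1 * (\<alpha> * r x))"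
    using gauged_radial_derivative[OF d a CI(1) dI CI(2,3), of \<nu> \<beta>]
    unfolding v_def r_def W_def A_def by blast
  have p: "\<bar>p t\<bar> \<le> CI * exp (\<alpha> * r t) / W t" for t
    using CI(2)[OF far, of t] W[of t] by (simp add: p_def divide_right_mono)
  have q: "\<bar>q t\<bar> \<le> CK * exp (- (\<alpha> * r t)) / W t" for t
    using CK(2)[OF far, of t] W[of t] by (simp add: q_def divide_right_mono)
  obtain M where M: "\<And>s. s \<ge> 0 \<Longrightarrow> \<bar>\<nu>\<bar> * ln (1 + s / \<delta>) \<le> M + c * s"
    using ln_le_linear[OF d c, of "\<bar>\<nu>\<bar>"] by auto
  define C where "C = A * CK * CI * exp (\<alpha> * \<delta> + M)"
  have C: "C \<ge> 0" using A CK(1) CI(1) by (simp add: C_def)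
  \<comment> \<open>The exponential factors of \<open>I\<close> and \<open>K\<close> leave \<open>exp (- \<alpha> (r(y) - r(z)))\<close>, where \<open>y\<close> is the outer and
    \<open>z\<close> the inner one of the points \<open>x\<close> and \<open>t\<close>.\<close>
  have kernel: "A * CK * CI * (W x / W t) * exp (- \<alpha> * (r y - r z)) \<le> C * exp (- c * \<bar>x - t\<bar>)"
    if "\<bar>x - t\<bar> - \<delta> \<le> r y - r z" for x t y z
  proof -
    have "W x / W t \<le> exp (\<bar>\<beta>\<bar> * \<bar>x - t\<bar> + \<bar>\<nu>\<bar> * ln (1 + \<bar>x - t\<bar> / \<delta>))"
      unfolding W_def by (rule gh_gauge_ratio[OF d])
    also have "\<dots> \<le> exp (\<bar>\<beta>\<bar> * \<bar>x - t\<bar> + (M + c * \<bar>x - t\<bar>))" using M[of "\<bar>x - t\<bar>"] by simp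
    finally have "W x / W t \<le> exp (\<bar>\<beta>\<bar> * \<bar>x - t\<bar> + (M + c * \<bar>x - t\<bar>))" .
    moreover have "exp (- \<alpha> * (r y - r z)) \<le> exp (- \<alpha> * (\<bar>x - t\<bar> - \<delta>))"
      using that a by simp
    ultimately have "(W x / W t) * exp (- \<alpha> * (r y - r z))
      \<le> exp (\<bar>\<beta>\<bar> * \<bar>x - t\<bar> + (M + c * \<bar>x - t\<bar>)) * exp (- \<alpha> * (\<bar>x - t\<bar> - \<delta>))"
      by (intro mult_mono) auto
    also have "\<dots> = exp (\<alpha> * \<delta> + M + (\<bar>\<beta>\<bar> + c - \<alpha>) * \<bar>x - t\<bar>)"
      by (simp add: algebra_simps flip: exp_add)
    also have "\<bar>\<beta>\<bar> + c - \<alpha> = - c" by (simp add: c_def field_simps)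
    finally have "(W x / W t) * exp (- \<alpha> * (r y - r z)) \<le> exp (\<alpha> * \<delta> + M + - c * \<bar>x - t\<bar>)" .
    then have "A * CK * CI * ((W x / W t) * exp (- \<alpha> * (r y - r z)))
      \<le> A * CK * CI * exp (\<alpha> * \<delta> + M + - c * \<bar>x - t\<bar>)"
      using A CK(1) CI(1) by (intro mult_left_mono) auto
    then show ?thesis by (simp add: C_def exp_add exp_diff mult_ac exp_minus field_simps)
  qed
  have upper: "\<bar>w * p t\<bar> \<le> C * exp (- c * \<bar>x - t\<bar>)"
    if w: "\<bar>w\<bar> \<le> A * CK * W x * exp (- 1 * (\<alpha> * r x))" and "0 \<le> x * t" "\<bar>t\<bar> \<le> \<bar>x\<bar>" for w x t
  proof -
    have "\<bar>w * p t\<bar> \<le> (A * CK * W x * exp (- 1 * (\<alpha> * r x))) * (CI * exp (\<alpha> * r t) / W t)"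
      unfolding abs_mult using w p by (rule mult_mono') auto
    also have "\<dots> = A * CK * CI * (W x / W t) * exp (- \<alpha> * (r x - r t))"
      by (simp add: algebra_simps exp_diff exp_minus field_simps)
    also have "\<dots> \<le> C * exp (- c * \<bar>x - t\<bar>)"
      using gh_radius_growth[OF d, of t x] that(2,3) by (intro kernel) (simp add: r_def mult.commute)
    finally show ?thesis .
  qed
  have lower: "\<bar>w * q t\<bar> \<le> C * exp (- c * \<bar>x - t\<bar>)"
    if w: "\<bar>w\<bar> \<le> A * CI * W x * exp (1 * (\<alpha> * r x))" and "0 \<le> x * t" "\<bar>x\<bar> \<le> \<bar>t\<bar>" for w x t
  proof -
    have "\<bar>w * q t\<bar> \<le> (A * CI * W x * exp (1 * (\<alpha> * r x))) * (CK * exp (- (\<alpha> * r t)) / W t)"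
      unfolding abs_mult using w q by (rule mult_mono') auto
    also have "\<dots> = A * CK * CI * (W x / W t) * exp (- \<alpha> * (r t - r x))"
      by (simp add: algebra_simps exp_diff exp_minus field_simps)
    also have "\<dots> \<le> C * exp (- c * \<bar>x - t\<bar>)"
      using gh_radius_growth[OF d, of x t] that(2,3)
      by (intro kernel) (simp add: r_def abs_minus_commute)
    finally show ?thesis .
  qed
  have Wc: "continuous_on UNIV W"
    using DERIV_isCont[OF gh_gauge_deriv[OF d, of \<nu> \<beta>]]
    by (simp add: W_def continuous_at_imp_continuous_on)
  have uc: "continuous_on UNIV u" and vc: "continuous_on UNIV v"
    using DERIV_isCont[OF du] DERIV_isCont[OF dv] by (simp_all add: continuous_at_imp_continuous_on)
  \<comment> \<open>Reduces continuity of the weights to that of the differentiable functions \<open>u\<close>, \<open>v\<close> and \<open>W\<close>.\<close>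
  have "p = (\<lambda>t. v t / (W t)\<^sup>2)" and "q = (\<lambda>t. u t / (W t)\<^sup>2)"
    using W by (simp_all add: p_def q_def u_def v_def fun_eq_iff power2_eq_square less_imp_neq[symmetric])
  then have pc: "continuous_on UNIV p" and qc: "continuous_on UNIV q"
    using W by (auto intro!: continuous_intros uc vc Wc simp: less_imp_neq[symmetric])
  have weight: "gh_weight \<nu> \<alpha> \<beta> \<delta> = q"
    by (simp add: fun_eq_iff gh_weight_def q_def W_def r_def gh_gauge_eq[OF d] gh_radius_def
        exp_minus field_simps add.commute)
  have cancel: "u x * p x = v x * q x" for x
    by (simp add: u_def v_def p_def q_def)
  define K where "K = 2 * C * (\<integral>t. exp (- c * \<bar>t\<bar>) \<partial>lborel)"
  have K: "K \<ge> 0" using C by (simp add: K_def)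
  have main: "sup_norm (gh_stein_solution lam \<alpha> \<beta> \<delta> h) \<le> ennreal K * sup_norm (gh_centred lam \<alpha> \<beta> \<delta> h) \<and>
    (\<forall>x. gh_stein_solution lam \<alpha> \<beta> \<delta> h differentiable (at x)) \<and>
    sup_norm (deriv (gh_stein_solution lam \<alpha> \<beta> \<delta> h)) \<le> ennreal K * sup_norm (gh_centred lam \<alpha> \<beta> \<delta> h)"
    if h: "h \<in> borel_measurable borel" "bounded (range h)" for h
  proof -
    define g where "g = gh_centred lam \<alpha> \<beta> \<delta> h"
    define f where "f = gh_stein_solution lam \<alpha> \<beta> \<delta> h"
    have gm: "g \<in> borel_measurable borel"
      using h(1) by (simp add: g_def gh_centred_def[abs_def])
    have "bounded (range g)"
    proof -
      have "range g = (\<lambda>y. y - gh_expectation lam \<alpha> \<beta> \<delta> h) ` range h"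
        by (auto simp: g_def gh_centred_def)
      then show ?thesis using bounded_minus_comp[of id "range h" "\<lambda>_. gh_expectation lam \<alpha> \<beta> \<delta> h"] h(2)
        by (simp add: image_constant_conv)
    qed
    then obtain B where B: "B \<ge> 0" "sup_norm g = ennreal B" "\<And>x. \<bar>g x\<bar> \<le> B"
      using sup_norm_bounded by blast
    have qm: "gh_weight (lam - 1 / 2) \<alpha> \<beta> \<delta> \<in> borel_measurable borel"
      using qc by (simp add: weight[unfolded \<nu>_def] borel_measurable_continuous_onI)
    note zero = gh_centred_mean_zero[OF assms h qm, unfolded weight[unfolded \<nu>_def], folded g_def]
    have f: "f = (\<lambda>x. - u x * (LBINT t=0..ereal x. p t * g t) - v x * (LBINT t=ereal x..\<infinity>. q t * g t))"
      by (simp add: f_def gh_stein_solution_def Let_def \<nu>_def[symmetric] g_def[symmetric] fun_eq_iff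
          u_def v_def p_def q_def W_def r_def gh_gauge_eq[OF d] gh_radius_def exp_minus field_simps)
    note vp = variation_of_parameters_bound[OF c C du dv pc qc cancel upper[OF u] upper[OF u']
        lower[OF v] lower[OF v'] gm B(3) zero, folded K_def f]
    have "\<bar>f x\<bar> \<le> K * B" for x unfolding f by (rule vp(1))
    moreover have "\<exists>d. (f has_real_derivative d) (at x) \<and> \<bar>d\<bar> \<le> K * B" for x by (rule vp(2))
    then have "f differentiable (at x)" "\<bar>deriv f x\<bar> \<le> K * B" for x
      by (metis real_differentiable_def, metis DERIV_imp_deriv)
    ultimately have "sup_norm f \<le> ennreal K * ennreal B \<and> (\<forall>x. f differentiable (at x)) \<and>
        sup_norm (deriv f) \<le> ennreal K * ennreal B"
      using K B(1) by (auto intro!: sup_norm_leI simp flip: ennreal_mult)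
    then show ?thesis by (simp add: f_def g_def[symmetric] B(2))
  qed
  show ?thesis using K main by blast
qed

end
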